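(* Let $\mathfrak{X}$ be an association scheme of rank $4$ on $n\ge29$ vertices with diameter $2$ and constituents ordered by degree, and suppose $k_2\le\varepsilon k_3/2$ where $\varepsilon=10^{-26}$. Suppose that $X_1$ is a strongly regular graph with smallest eigenvalue $-2$. Then $q(Y)+\xi(Y)\le(1-\varepsilon)k_Y$, where either $Y=X_2$ and $k_Y=k_2$, or $Y=X_{1,2}$ and $k_Y=k_1+k_2$.
   Context: An association scheme of rank $r$ on a finite vertex set $V$ ($|V|=n$) is a surjective map $c:V\times V\to\{0,1,\dots,r-1\}$ such that $c(u,v)=0$ iff $u=v$, $c(u,v)=c(v,u)$, and for all colors $i,j,t$ there is an integer $p^t_{i,j}$ such that whenever $c(u,v)=t$ there are exactly $p^t_{i,j}$ vertices $w$ with $c(u,w)=i$, $c(w,v)=j$. The constituent $X_i$ is the graph on $V$ with distinct $u,v$ adjacent iff $c(u,v)=i$; it is regular of degree $k_i=p^0_{i,i}$. $X_{1,2}$ is the graph on $V$ with $u,v$ adjacent iff $c(u,v)\in\{1,2\}$. The scheme has diameter $2$ if every $X_i$ ($i\ne0$) has diameter at most $2$ and some has diameter exactly $2$. Constituents are ordered by degree if $k_1\le k_2\le k_3$. For a graph $X$, $q(X)$ is the maximum number of common neighbours of two distinct vertices. For a $k$-regular graph with adjacency eigenvalues $k=\xi_1\ge\dots\ge\xi_n$, the zero-weight spectral radius is $\xi(X)=\max\{|\xi_i|:2\le i\le n\}$. *)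

theory Defs
  imports
    "HOL-Analysis.Analysis"
    "HOL-Library.Extended_Nat"
    "HOL-Computational_Algebra.Polynomial"
begin

text \<open>
  A graph on a finite vertex type \<open>'v\<close> is given by its adjacency relation; every graph
  considered here is symmetric and irreflexive.
\<close>

type_synonym 'v graph = "'v \<Rightarrow> 'v \<Rightarrow> bool"

definition common_neighbours :: "'v graph \<Rightarrow> 'v \<Rightarrow> 'v \<Rightarrow> 'v set" where
  "common_neighbours X u v = {w. X u w \<and> X v w}"

definition regular_graph :: "'v::finite graph \<Rightarrow> nat \<Rightarrow> bool" where
  "regular_graph X k \<longleftrightarrow> (\<forall>u. card {v. X u v} = k)"

definition strongly_regular_graph :: "'v::finite graph \<Rightarrow> nat \<Rightarrow> nat \<Rightarrow> nat \<Rightarrow> bool" where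
  "strongly_regular_graph X k l m \<longleftrightarrow>
     regular_graph X k \<and>
     (\<forall>u v. X u v \<longrightarrow> card (common_neighbours X u v) = l) \<and>
     (\<forall>u v. u \<noteq> v \<and> \<not> X u v \<longrightarrow> card (common_neighbours X u v) = m)"

text \<open>
  Length of a shortest walk; the infimum of the empty set is \<open>\<infinity>\<close>, so a disconnected
  graph has infinite diameter.
\<close>

definition graph_dist :: "'v graph \<Rightarrow> 'v \<Rightarrow> 'v \<Rightarrow> enat" where
  "graph_dist X u v = Inf {enat l | l. (X ^^ l) u v}"

definition graph_diameter :: "'v graph \<Rightarrow> enat" where
  "graph_diameter X = Sup {graph_dist X u v | u v. True}"

definition max_common_neighbours :: "'v::finite graph \<Rightarrow> nat" where
  "max_common_neighbours X = Max {card (common_neighbours X u v) | u v. u \<noteq> v}"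

definition adjacency_matrix :: "'v::finite graph \<Rightarrow> real ^ 'v ^ 'v" where
  "adjacency_matrix X = (\<chi> u v. if X u v then 1 else 0)"

definition matrix_charpoly :: "real ^ 'n ^ 'n \<Rightarrow> real poly" where
  "matrix_charpoly A = det (mat [:0, 1:] - (\<chi> i j. [:A $ i $ j:]))"

text \<open>
  The adjacency eigenvalues in decreasing order, repeated according to multiplicity. All roots
  of the characteristic polynomial of a symmetric real matrix are real, with algebraic
  multiplicity equal to the geometric one, so for a symmetric graph this list has
  \<open>CARD('v)\<close> entries.
\<close>

definition graph_eigenvalues :: "'v::finite graph \<Rightarrow> real list" where
  "graph_eigenvalues X = rev (sorted_list_of_multiset (proots (matrix_charpoly (adjacency_matrix X))))"

definition smallest_eigenvalue :: "'v::finite graph \<Rightarrow> real" where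
  "smallest_eigenvalue X = last (graph_eigenvalues X)"

text \<open>
  The head of the list of eigenvalues of a regular graph is its degree; only this one
  occurrence is discarded.
\<close>

definition zero_weight_spectral_radius :: "'v::finite graph \<Rightarrow> real" where
  "zero_weight_spectral_radius X = Max (abs ` set (tl (graph_eigenvalues X)))"

definition association_scheme :: "nat \<Rightarrow> ('v::finite \<Rightarrow> 'v \<Rightarrow> nat) \<Rightarrow> bool" where
  "association_scheme r c \<longleftrightarrow>
     (\<lambda>(u, v). c u v) ` UNIV = {0..<r} \<and>
     (\<forall>u v. c u v = 0 \<longleftrightarrow> u = v) \<and>
     (\<forall>u v. c u v = c v u) \<and>
     (\<forall>i<r. \<forall>j<r. \<forall>t<r. \<exists>p. \<forall>u v. c u v = t \<longrightarrow> card {w. c u w = i \<and> c w v = j} = p)"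

text \<open>\<open>intersection_number c t i j\<close> is \<open>p\<^sup>t\<^bsub>i,j\<^esub>\<close>; it is unique because every colour is attained.\<close>

definition intersection_number :: "('v::finite \<Rightarrow> 'v \<Rightarrow> nat) \<Rightarrow> nat \<Rightarrow> nat \<Rightarrow> nat \<Rightarrow> nat" where
  "intersection_number c t i j =
     (THE p. \<forall>u v. c u v = t \<longrightarrow> card {w. c u w = i \<and> c w v = j} = p)"

definition constituent_degree :: "('v::finite \<Rightarrow> 'v \<Rightarrow> nat) \<Rightarrow> nat \<Rightarrow> nat" where
  "constituent_degree c i = intersection_number c 0 i i"

definition constituent :: "('v \<Rightarrow> 'v \<Rightarrow> nat) \<Rightarrow> nat \<Rightarrow> 'v graph" where
  "constituent c i = (\<lambda>u v. u \<noteq> v \<and> c u v = i)"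

definition constituent_union :: "('v \<Rightarrow> 'v \<Rightarrow> nat) \<Rightarrow> nat \<Rightarrow> nat \<Rightarrow> 'v graph" where
  "constituent_union c i j = (\<lambda>u v. c u v \<in> {i, j})"

definition scheme_diameter_2 :: "nat \<Rightarrow> ('v \<Rightarrow> 'v \<Rightarrow> nat) \<Rightarrow> bool" where
  "scheme_diameter_2 r c \<longleftrightarrow>
     (\<forall>i\<in>{1..<r}. graph_diameter (constituent c i) \<le> 2) \<and>
     (\<exists>i\<in>{1..<r}. graph_diameter (constituent c i) = 2)"

lemma poly_matrix_charpoly: "poly (matrix_charpoly A) x = det (mat x - A)"
proof -
  have "poly ((mat [:0, 1:] - (\<chi> i j. [:A $ i $ j:])) $ i $ j) x = (mat x - A) $ i $ j" for i j
    by (simp add: mat_def)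
  then show ?thesis
    by (simp add: matrix_charpoly_def det_def poly_sum poly_prod)
qed

lemma poly_matrix_charpoly_eq_0_iff:
  "poly (matrix_charpoly A) x = 0 \<longleftrightarrow> (\<exists>v. v \<noteq> 0 \<and> A *v v = x *\<^sub>R v)"
proof -
  have "(mat x - A) *v v = x *\<^sub>R v - A *v v" for v
  proof -
    have "mat x *v v = x *\<^sub>R v"
      by (simp add: vec_eq_iff matrix_vector_mult_def mat_def if_distrib if_distribR cong: if_cong)
    then show ?thesis
      by (simp add: matrix_vector_mult_diff_rdistrib)
  qed
  moreover have "det (mat x - A) = 0 \<longleftrightarrow> (\<exists>v. v \<noteq> 0 \<and> (mat x - A) *v v = 0)"
    using invertible_det_nz[of "mat x - A"] matrix_left_invertible_ker[of "mat x - A"]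
      invertible_left_inverse[of "mat x - A"] by metis
  ultimately show ?thesis
    by (simp add: poly_matrix_charpoly) (metis)
qed

lemma matrix_charpoly_nonzero: "matrix_charpoly A \<noteq> 0"
proof
  assume "matrix_charpoly A = 0"
  then obtain v where v: "v \<noteq> 0" "A *v v = (onorm ((*v) A) + 1) *\<^sub>R v"
    using poly_matrix_charpoly_eq_0_iff[of A "onorm ((*v) A) + 1"] by auto
  have "bounded_linear ((*v) A)"
    by (rule matrix_vector_mul_bounded_linear)
  then have "norm (A *v v) \<le> onorm ((*v) A) * norm v" "0 \<le> onorm ((*v) A)"
    by (simp_all add: onorm onorm_pos_le)
  then have "(onorm ((*v) A) + 1) * norm v \<le> onorm ((*v) A) * norm v"
    by (simp add: v(2))
  with v(1) show False
    by simp
qed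

lemma set_graph_eigenvalues:
  "set (graph_eigenvalues X) = {x. \<exists>v. v \<noteq> 0 \<and> adjacency_matrix X *v v = x *\<^sub>R v}"
  by (simp add: graph_eigenvalues_def matrix_charpoly_nonzero poly_matrix_charpoly_eq_0_iff)

end

theory Submission
  imports Defs
begin

text \<open>
  Let \<open>X\<^sub>1\<close> have parameters \<open>(k\<^sub>1, l, m)\<close> and eigenvalues \<open>k\<^sub>1, R, -2\<close>. Since the scheme has rank 4,
  the adjacency matrix \<open>A\<^sub>2\<close> splits exactly one of the two nontrivial eigenspaces of \<open>X\<^sub>1\<close>. If it
  split the \<open>R\<close>-eigenspace, then \<open>k\<^sub>2 / (k\<^sub>2 + k\<^sub>3)\<close> would be a difference of intersection numbers,
  hence an integer. So it splits the \<open>-2\<close>-eigenspace, which determines all relevant parameters except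
  \<open>\<lambda> = p\<^sup>2\<^bsub>2,2\<^esub>\<close>: the numbers \<open>p\<^sup>1\<^bsub>2,2\<^esub>\<close>, \<open>p\<^sup>3\<^bsub>2,2\<^esub>\<close> and the eigenvalue of \<open>A\<^sub>2\<close> on the \<open>R\<close>-eigenspace are
  negligible against \<open>k\<^sub>2\<close>, and the two eigenvalues on the \<open>-2\<close>-eigenspace are at most about \<open>\<lambda>\<close> in
  absolute value. If \<open>\<lambda>\<close> is at most \<open>9/20 k\<^sub>2\<close>, then \<open>X\<^sub>2\<close> has the required property. Otherwise \<open>\<lambda>\<close> is close
  to \<open>k\<^sub>2/2\<close>, and \<open>X\<^sub>2\<close> is the collinearity graph of a partial linear space with two lines through
  each point. This forces \<open>p\<^sup>1\<^bsub>2,2\<^esub> \<le> 4\<close>, hence \<open>k\<^sub>2 \<le> 3 k\<^sub>1\<close>, and \<open>X\<^sub>1\<^sub>,\<^sub>2\<close> has the required property.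
\<close>

section \<open>Eigenvalues of regular graphs\<close>

lemma adjacency_matrix_mult_component:
  "(adjacency_matrix X *v x) $ u = (\<Sum>w | X u w. x $ w)"
proof -
  have "(adjacency_matrix X *v x) $ u = (\<Sum>w\<in>UNIV. if X u w then x $ w else 0)"
    unfolding adjacency_matrix_def matrix_vector_mult_def
    by (simp add: if_distribR if_distrib cong: if_cong)
  also have "\<dots> = (\<Sum>w | X u w. x $ w)"
    by (simp add: sum.If_cases)
  finally show ?thesis .
qed

text \<open>The eigenvalue equation is read off at a coordinate of maximal absolute value.\<close>

lemma regular_graph_eigenvalue_le:
  fixes X :: "'v::finite graph"
  assumes reg: "regular_graph X k" and x: "x \<noteq> 0" "adjacency_matrix X *v x = a *\<^sub>R x"
  shows "a \<le> real k"
proof -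
  let ?S = "range (\<lambda>w. \<bar>x $ w\<bar>)"
  have "Max ?S \<in> ?S"
    by (intro Max_in) auto
  then obtain u where "\<bar>x $ u\<bar> = Max ?S"
    by (metis (no_types, lifting) imageE)
  then have u: "\<bar>x $ w\<bar> \<le> \<bar>x $ u\<bar>" for w
    by simp
  have pos: "0 < \<bar>x $ u\<bar>"
  proof (rule ccontr)
    assume "\<not> 0 < \<bar>x $ u\<bar>"
    then have "x $ w = 0" for w
      using u[of w] by simp
    with x(1) show False
      by (simp add: vec_eq_iff)
  qed
  have "a * x $ u = (\<Sum>w | X u w. x $ w)"
    using arg_cong[OF x(2), of "\<lambda>y. y $ u"] by (simp add: adjacency_matrix_mult_component)
  then have "\<bar>a\<bar> * \<bar>x $ u\<bar> \<le> (\<Sum>w | X u w. \<bar>x $ w\<bar>)"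
    by (metis abs_mult sum_abs)
  also have "\<dots> \<le> real (card {w. X u w}) * \<bar>x $ u\<bar>"
    using u by (intro sum_bounded_above) auto
  finally show ?thesis
    using pos reg by (simp add: regular_graph_def)
qed

text \<open>
  Adding all other rows of \<open>x I - A\<close> to one row turns that row into \<open>x - k\<close> times the all-ones
  vector, so the characteristic polynomial is \<open>x - k\<close> times the determinant of a matrix whose
  kernel consists of the \<open>x\<close>-eigenvectors of weight zero.
\<close>

lemma set_tl_graph_eigenvalues:
  fixes X :: "'v::finite graph"
  assumes sym: "\<And>u v. X u v \<Longrightarrow> X v u" and reg: "regular_graph X k"
  shows "set (tl (graph_eigenvalues X)) =
    {a. \<exists>x. x \<noteq> 0 \<and> (\<Sum>u\<in>UNIV. x $ u) = 0 \<and> adjacency_matrix X *v x = a *\<^sub>R x}"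
proof -
  define A where "A = adjacency_matrix X"
  define z where "z = (undefined :: 'v)"
  define M where "M a = (\<chi> i. if i = z then 1 else row i (mat a - A))" for a :: real
  define g where "g = det (\<chi> i j. if i = z then 1
    else (mat [:0, 1:] - (\<chi> i j. [:A $ i $ j:])) $ i $ j)"
  have poly_g: "poly g a = det (M a)" for a
  proof -
    have "poly ((\<chi> i j. if i = z then 1 else (mat [:0, 1:] - (\<chi> i j. [:A $ i $ j:])) $ i $ j) $ i $ j) a
        = M a $ i $ j" for i j
      by (simp add: mat_def M_def row_def)
    then show ?thesis
      by (simp add: g_def det_def poly_sum poly_prod del: vec_lambda_beta)
  qed
  have colsum: "(\<Sum>i\<in>UNIV. A $ i $ j) = real k" for j
  proof -
    have "{i. X i j} = {i. X j i}"
      using sym by blast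
    then show ?thesis
      using reg by (simp add: A_def adjacency_matrix_def sum.If_cases regular_graph_def)
  qed
  have rowsum: "(\<Sum>i\<in>UNIV. row i (mat a - A)) = (a - real k) *s 1" for a
  proof -
    have "(\<Sum>i\<in>UNIV. row i (mat a - A)) $ j = (a - real k)" for j
      by (simp add: row_def sum_subtractf colsum mat_def)
    then show ?thesis
      by (simp add: vec_eq_iff)
  qed
  have det_factor: "det (mat a - A) = (a - real k) * det (M a)" for a
  proof -
    let ?B = "mat a - A"
    have span: "(\<Sum>i\<in>UNIV - {z}. row i ?B) \<in> vec.span {row j ?B |j. j \<noteq> z}"
      by (intro vec.span_sum vec.span_base) auto
    have "row z ?B + (\<Sum>i\<in>UNIV - {z}. row i ?B) = (a - real k) *s 1"
      using rowsum[of a] sum.remove[of UNIV z "\<lambda>i. row i ?B"] by (metis UNIV_I finite)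
    then have "det ?B = det (\<chi> i. if i = z then (a - real k) *s 1 else row i ?B)"
      using det_row_span[OF span] by (simp only:)
    also have "\<dots> = (a - real k) * det (M a)"
      unfolding M_def by (rule det_row_mul)
    finally show ?thesis .
  qed
  have charpoly: "matrix_charpoly A = [:- real k, 1:] * g"
  proof -
    have "poly (matrix_charpoly A) a = poly ([:- real k, 1:] * g) a" for a
      by (simp add: poly_matrix_charpoly det_factor poly_g algebra_simps)
    then show ?thesis
      by (simp add: poly_eq_poly_eq_iff[symmetric] fun_eq_iff)
  qed
  have nz: "g \<noteq> 0"
    using matrix_charpoly_nonzero[of A] charpoly by auto
  let ?xs = "graph_eigenvalues X"
  have mset: "mset ?xs = add_mset (real k) (proots g)"
  proof -
    have "proots (matrix_charpoly A) = add_mset (real k) (proots g)"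
      unfolding charpoly using nz by (subst proots_mult) auto
    then show ?thesis
      by (simp add: graph_eigenvalues_def A_def)
  qed
  then obtain y ys where xs: "?xs = y # ys"
    by (cases ?xs) auto
  \<comment> \<open>The head \<open>y\<close> is the largest eigenvalue and hence equals
    \<open>k\<close>, so \<open>tl\<close> removes exactly the root of the linear factor that was
    split off.\<close>
  have "sorted (rev ?xs)"
    by (simp add: graph_eigenvalues_def)
  then have "a \<le> y" if "a \<in> set ?xs" for a
    using that by (auto simp: xs sorted_append)
  moreover have "real k \<in> set ?xs"
    using arg_cong[OF mset, of set_mset] by simp
  moreover have "y \<le> real k"
  proof -
    have "y \<in> set ?xs"
      by (simp add: xs)
    then show ?thesis
      using regular_graph_eigenvalue_le[OF reg] unfolding set_graph_eigenvalues by blast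
  qed
  ultimately have "y = real k"
    by force
  then have "mset (tl ?xs) = proots g"
    using mset by (simp add: xs)
  then have "set (tl ?xs) = {a. poly g a = 0}"
    using nz by (metis set_count_proots set_mset_mset)
  also have "\<dots> = {a. \<exists>x. x \<noteq> 0 \<and> (\<Sum>u\<in>UNIV. x $ u) = 0 \<and> A *v x = a *\<^sub>R x}"
  proof -
    have "det (M a) = 0 \<longleftrightarrow> (\<exists>x. x \<noteq> 0 \<and> M a *v x = 0)" for a
      using invertible_det_nz[of "M a"] matrix_left_invertible_ker[of "M a"]
        invertible_left_inverse[of "M a"] by metis
    moreover have "M a *v x = 0 \<longleftrightarrow> (\<Sum>u\<in>UNIV. x $ u) = 0 \<and> A *v x = a *\<^sub>R x" for a x
    proof -
      have comp: "(M a *v x) $ i = (if i = z then \<Sum>u\<in>UNIV. x $ u else ((mat a - A) *v x) $ i)" for i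
        by (simp add: M_def matrix_vector_mult_def row_def)
      have "mat a *v x = a *\<^sub>R x"
        by (simp add: vec_eq_iff matrix_vector_mult_def mat_def if_distrib if_distribR cong: if_cong)
      then have eig: "A *v x = a *\<^sub>R x \<longleftrightarrow> (mat a - A) *v x = 0"
        by (auto simp: matrix_vector_mult_diff_rdistrib)
      \<comment> \<open>The overwritten row \<open>z\<close> is recovered from the others: the
        coordinates of \<open>(mat a - A) *v x\<close> sum to \<open>a - k\<close> times the weight
        of \<open>x\<close>.\<close>
      have "(\<Sum>i\<in>UNIV. ((mat a - A) *v x) $ i) = (\<Sum>j\<in>UNIV. (\<Sum>i\<in>UNIV. (mat a - A) $ i $ j) * x $ j)"
        unfolding matrix_vector_mult_def by (simp add: sum_distrib_right) (rule sum.swap)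
      also have "\<dots> = (\<Sum>j\<in>UNIV. (a - real k) * x $ j)"
        using arg_cong[OF rowsum[of a], of "\<lambda>y. y $ j" for j] by (simp add: row_def)
      finally have total: "(\<Sum>i\<in>UNIV. ((mat a - A) *v x) $ i) = (a - real k) * (\<Sum>j\<in>UNIV. x $ j)"
        by (simp add: sum_distrib_left)
      show ?thesis
      proof
        assume M0: "M a *v x = 0"
        have s0: "(\<Sum>u\<in>UNIV. x $ u) = 0"
          using comp[of z] M0 by simp
        have off: "((mat a - A) *v x) $ i = 0" if "i \<noteq> z" for i
          using comp[of i] M0 that by simp
        have "((mat a - A) *v x) $ z = 0"
          using total s0 off by (simp add: sum.remove[of UNIV z])
        then show "(\<Sum>u\<in>UNIV. x $ u) = 0 \<and> A *v x = a *\<^sub>R x"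
          using s0 off unfolding eig by (metis vec_eq_iff zero_index)
      next
        assume "(\<Sum>u\<in>UNIV. x $ u) = 0 \<and> A *v x = a *\<^sub>R x"
        then show "M a *v x = 0"
          unfolding eig by (simp add: vec_eq_iff comp)
      qed
    qed
    ultimately show ?thesis
      by (simp add: poly_g)
  qed
  finally show ?thesis
    by (simp add: A_def)
qed

text \<open>The tail of the eigenvalue list holds the eigenvalues with an eigenvector of weight
  zero; \<open>ex\<close> makes the set under \<open>Max\<close> nonempty.\<close>

lemma zero_weight_spectral_radius_le:
  fixes X :: "'v::finite graph"
  assumes sym: "\<And>u v. X u v \<Longrightarrow> X v u" and reg: "regular_graph X k"
    and ex: "\<exists>a x. x \<noteq> 0 \<and> (\<Sum>u\<in>UNIV. x $ u) = 0 \<and> adjacency_matrix X *v x = a *\<^sub>R x"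
    and bound: "\<And>a x. x \<noteq> 0 \<Longrightarrow> (\<Sum>u\<in>UNIV. x $ u) = 0 \<Longrightarrow> adjacency_matrix X *v x = a *\<^sub>R x
      \<Longrightarrow> \<bar>a\<bar> \<le> B"
  shows "zero_weight_spectral_radius X \<le> B"
proof -
  have "set (tl (graph_eigenvalues X)) \<noteq> {}"
    using ex set_tl_graph_eigenvalues[OF sym reg] by auto
  moreover have "\<bar>a\<bar> \<le> B" if "a \<in> set (tl (graph_eigenvalues X))" for a
    using that bound by (auto simp: set_tl_graph_eigenvalues[OF sym reg])
  ultimately show ?thesis
    unfolding zero_weight_spectral_radius_def by (subst Max_le_iff) auto
qed

lemma max_common_neighbours_le:
  fixes X :: "'v::finite graph"
  assumes "2 \<le> CARD('v)"
    and "\<And>u v. u \<noteq> v \<Longrightarrow> real (card (common_neighbours X u v)) \<le> B"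
  shows "real (max_common_neighbours X) \<le> B"
proof -
  let ?S = "{card (common_neighbours X u v) | u v. u \<noteq> v}"
  obtain u v :: 'v where "u \<noteq> v"
    using assms(1) by (metis card_2_iff ex_card top_greatest)
  then have "?S \<noteq> {}" by blast
  moreover have "finite ?S"
    by (rule finite_subset[of _ "(\<lambda>(u, v). card (common_neighbours X u v)) ` UNIV"]) auto
  ultimately have "max_common_neighbours X \<in> ?S"
    unfolding max_common_neighbours_def by (rule Max_in[rotated])
  then show ?thesis
    using assms(2) by auto
qed

lemma graph_diameter_le_2D:
  assumes "graph_diameter X \<le> 2" "u \<noteq> v" "\<not> X u v"
  shows "\<exists>w. X u w \<and> X w v"
proof -
  have "graph_dist X u v \<le> graph_diameter X"
    unfolding graph_diameter_def by (rule Sup_upper) blast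
  then have le: "Inf {enat l | l. (X ^^ l) u v} \<le> 2"
    using assms(1) by (simp add: graph_dist_def)
  \<comment> \<open>An empty set of walk lengths would have infimum \<infinity>; a nonempty one
    attains its infimum.\<close>
  then have "{enat l | l. (X ^^ l) u v} \<noteq> {}"
    by (cases "{enat l | l. (X ^^ l) u v} = {}") (simp_all only: Inf_empty, auto simp: top_enat_def)
  then have "Inf {enat l | l. (X ^^ l) u v} \<in> {enat l | l. (X ^^ l) u v}"
    unfolding Inf_enat_def by (metis (mono_tags, lifting) LeastI ex_in_conv)
  then obtain l where l: "(X ^^ l) u v" "enat l \<le> 2"
    using le by auto
  then have "l \<le> 2"
    by (simp add: numeral_eq_enat)
  then consider "l = 0" | "l = 1" | "l = 2"
    by linarith
  then show ?thesis
    using l(1) assms(2,3) by cases (auto simp: numeral_2_eq_2 relcompp_apply)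
qed

section \<open>Graphs that are locally two cliques\<close>

definition is_clique :: "'v graph \<Rightarrow> 'v set \<Rightarrow> bool" where
  "is_clique X K \<longleftrightarrow> (\<forall>x\<in>K. \<forall>y\<in>K. x \<noteq> y \<longrightarrow> X x y)"

text \<open>Inclusion-exclusion, cut off after the pairwise intersections.\<close>

lemma card_Un3_ge:
  assumes "finite A" "finite B" "finite C"
  shows "card A + card B + card C \<le>
    card (A \<union> B \<union> C) + card (A \<inter> B) + card (A \<inter> C) + card (B \<inter> C)"
proof -
  have "card A + card B = card (A \<union> B) + card (A \<inter> B)"
    using assms by (intro card_Un_Int) auto
  moreover have "card (A \<union> B) + card C = card (A \<union> B \<union> C) + card ((A \<union> B) \<inter> C)"
    using assms by (intro card_Un_Int) auto
  moreover have "card ((A \<union> B) \<inter> C) \<le> card (A \<inter> C) + card (B \<inter> C)"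
    by (metis Int_Un_distrib2 card_Un_le)
  ultimately show ?thesis by linarith
qed

text \<open>The common neighbours of \<open>v\<close> with \<open>u\<close> and those of
  \<open>v\<close> with \<open>w\<close> lie among the \<open>k\<close> neighbours of
  \<open>v\<close> and overlap in at most \<open>t\<close> vertices.\<close>

lemma two_mult_common_neighbours_le:
  fixes X :: "'v::finite graph"
  assumes reg: "regular_graph X k"
    and adj: "\<And>u v. X u v \<Longrightarrow> card (common_neighbours X u v) = l"
    and nadj: "\<And>u v. u \<noteq> v \<Longrightarrow> \<not> X u v \<Longrightarrow> card (common_neighbours X u v) \<le> t"
    and uvw: "X v u" "X v w" "u \<noteq> w" "\<not> X u w"
  shows "2 * l \<le> k + t"
proof -
  let ?A = "common_neighbours X v u" and ?B = "common_neighbours X v w"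
  have "card ?A + card ?B = card (?A \<union> ?B) + card (?A \<inter> ?B)"
    by (intro card_Un_Int) auto
  moreover have "card (?A \<union> ?B) \<le> card {x. X v x}"
    by (intro card_mono) (auto simp: common_neighbours_def)
  moreover have "card (?A \<inter> ?B) \<le> card (common_neighbours X u w)"
    by (intro card_mono) (auto simp: common_neighbours_def)
  ultimately show ?thesis
    using adj[of v u] adj[of v w] nadj[of u w] reg uvw by (simp add: regular_graph_def)
qed

text \<open>
  The maximal cliques with at least \<open>k - l\<close> vertices behave like the lines of a partial linear
  space with at most two lines through each point in which collinearity is adjacency; a common
  neighbour of \<open>u\<close> and \<open>w\<close> is then the intersection of a line through \<open>u\<close> and one through \<open>w\<close>.
\<close>

lemma common_neighbours_le_4:
  fixes X :: "'v::finite graph"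
  assumes sym: "\<And>u v. X u v \<Longrightarrow> X v u" and irr: "\<And>u. \<not> X u u"
    and reg: "regular_graph X k"
    and adj: "\<And>u v. X u v \<Longrightarrow> card (common_neighbours X u v) = l"
    and nadj: "\<And>u v. u \<noteq> v \<Longrightarrow> \<not> X u v \<Longrightarrow> card (common_neighbours X u v) \<le> t"
    and lower: "k + 3 * t < 3 * l" and upper: "3 * l + t + 3 < 2 * k"
    and uw: "u \<noteq> w" "\<not> X u w"
  shows "card (common_neighbours X u w) \<le> 4"
proof -
  have deg: "card {y. X v y} = k" for v
    using reg by (simp add: regular_graph_def)
  \<comment> \<open>The common neighbours of \<open>v\<close> with each of three pairwise
    nonadjacent neighbours would, by \<open>lower\<close>, not fit among the \<open>k\<close>
    neighbours of \<open>v\<close>.\<close>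
  have no_coclique: False
    if v: "X v x" "X v y" "X v z" and ne: "x \<noteq> y" "x \<noteq> z" "y \<noteq> z"
      and na: "\<not> X x y" "\<not> X x z" "\<not> X y z" for v x y z
  proof -
    let ?N = "common_neighbours X v"
    have "card (?N x \<union> ?N y \<union> ?N z) \<le> card {x. X v x}"
      by (intro card_mono) (auto simp: common_neighbours_def)
    moreover have "card (?N x \<inter> ?N y) \<le> card (common_neighbours X x y)"
      "card (?N x \<inter> ?N z) \<le> card (common_neighbours X x z)"
      "card (?N y \<inter> ?N z) \<le> card (common_neighbours X y z)"
      by (intro card_mono; auto simp: common_neighbours_def)+
    ultimately show False
      using card_Un3_ge[of "?N x" "?N y" "?N z"] adj[OF v(1)] adj[OF v(2)] adj[OF v(3)]
        nadj[OF ne(1) na(1)] nadj[OF ne(2) na(2)] nadj[OF ne(3) na(3)] deg[of v] lower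
      by simp
  qed
  \<comment> \<open>The bound \<open>k - l\<close> is the size of the clique \<open>K\<close>
    constructed next.\<close>
  define line where
    "line L \<longleftrightarrow> is_clique X L \<and> k - l \<le> card L \<and> (\<forall>K. is_clique X K \<and> L \<subseteq> K \<longrightarrow> K = L)" for L
  have line_through: "\<exists>L. line L \<and> v \<in> L \<and> x \<in> L" if vx: "X v x" for v x
  proof -
    have "card (common_neighbours X v x \<union> {x}) < card {y. X v y}"
      using adj[OF vx] deg[of v] upper card_Un_le[of "common_neighbours X v x" "{x}"] by simp
    then have "\<not> {y. X v y} \<subseteq> common_neighbours X v x \<union> {x}"
      by (meson card_mono finite leD)
    then obtain w where w: "X v w" "w \<noteq> x" "\<not> X x w"
      by (auto simp: common_neighbours_def)
    \<comment> \<open>Two nonadjacent members of \<open>K\<close> would form a forbidden triple with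
      \<open>w\<close>, so \<open>K\<close> is a clique; it contains \<open>x\<close> by the choice
      of \<open>w\<close>.\<close>
    define K where "K = insert v {y. X v y \<and> y \<noteq> w \<and> \<not> X w y}"
    have K: "is_clique X K"
      using no_coclique[of v _ _ w] w(1) sym unfolding is_clique_def K_def by blast
    have "{y. X v y \<and> y \<noteq> w \<and> \<not> X w y} = {y. X v y} - insert w (common_neighbours X v w)"
      by (auto simp: common_neighbours_def)
    moreover have "card ({y. X v y} - insert w (common_neighbours X v w)) = k - Suc l"
      using w(1) irr adj[OF w(1)]
      by (subst card_Diff_subset) (auto simp: common_neighbours_def deg)
    ultimately have cardK: "k - l \<le> card K"
      using irr upper by (auto simp: K_def)
    have vxK: "v \<in> K" "x \<in> K"
      using vx w sym by (auto simp: K_def)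
    obtain L where L: "K \<subseteq> L" "is_clique X L" "\<And>K'. is_clique X K' \<Longrightarrow> L \<subseteq> K' \<Longrightarrow> L = K'"
      using finite_has_maximal2[of "{L. is_clique X L}" K] K by auto
    have "card K \<le> card L"
      using L(1) by (intro card_mono) auto
    then have "line L"
      using L cardK unfolding line_def by fastforce
    then show ?thesis
      using L(1) vxK by blast
  qed
  have line_unique: "L = L'"
    if L: "line L" "line L'" and v: "v \<in> L" "v \<in> L'" and x: "x \<in> L" "x \<in> L'" and "v \<noteq> x" for L L' v x
  proof -
    have vx: "X v x"
      using L(1) v(1) x(1) \<open>v \<noteq> x\<close> by (auto simp: line_def is_clique_def)
    \<comment> \<open>Both lines lie in a set of \<open>l + 2\<close> vertices, so by
      \<open>upper\<close> they overlap in at least \<open>2 * (k - l) - (l + 2) > t\<close>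
      vertices. Nonadjacent \<open>y\<close> and \<open>z\<close> would have the whole overlap as
      common neighbours. So the union is a clique, and maximality makes the lines equal.\<close>
    have "L \<union> L' \<subseteq> {v, x} \<union> common_neighbours X v x"
      using L v x by (auto simp: line_def is_clique_def common_neighbours_def)
    then have "card (L \<union> L') \<le> card ({v, x} \<union> common_neighbours X v x)"
      by (intro card_mono) auto
    also have "\<dots> \<le> l + 2"
      using card_Un_le[of "{v, x}" "common_neighbours X v x"] adj[OF vx] \<open>v \<noteq> x\<close> by simp
    finally have "card (L \<union> L') \<le> l + 2" .
    moreover have "k - l \<le> card L" "k - l \<le> card L'"
      using L by (simp_all add: line_def)
    ultimately have big: "t < card (L \<inter> L')"
      using card_Un_Int[of L L'] upper by simp
    have "X y z" if yz: "y \<in> L" "z \<in> L'" "y \<noteq> z" for y z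
    proof (rule ccontr)
      assume na: "\<not> X y z"
      have "L \<inter> L' \<subseteq> common_neighbours X y z"
      proof
        fix x assume x: "x \<in> L \<inter> L'"
        then have "x \<noteq> y" "x \<noteq> z"
          using L yz na by (auto simp: line_def is_clique_def)
        then show "x \<in> common_neighbours X y z"
          using L yz x by (simp add: line_def is_clique_def common_neighbours_def)
      qed
      then have "card (L \<inter> L') \<le> card (common_neighbours X y z)"
        by (intro card_mono) auto
      with nadj[OF yz(3) na] big show False by simp
    qed
    moreover have "is_clique X L" "is_clique X L'"
      using L by (simp_all add: line_def)
    ultimately have "is_clique X (L \<union> L')"
      using sym unfolding is_clique_def by (metis UnE)
    then have "L \<union> L' = L" "L \<union> L' = L'"
      using L by (simp_all add: line_def)
    then show ?thesis
      by simp
  qed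
  have lines_at: "card {L. line L \<and> v \<in> L} \<le> 2" for v
  proof (rule ccontr)
    assume "\<not> card {L. line L \<and> v \<in> L} \<le> 2"
    then obtain S where S: "S \<subseteq> {L. line L \<and> v \<in> L}" "card S = 3"
      using obtain_subset_with_card_n[of 3 "{L. line L \<and> v \<in> L}"] by auto
    \<comment> \<open>Lines through \<open>v\<close> are disjoint outside \<open>v\<close>, so three
      of them would give \<open>3 * (k - l - 1) > k\<close> neighbours.\<close>
    have "card (\<Union>L\<in>S. L - {v}) = (\<Sum>L\<in>S. card (L - {v}))"
    proof (intro card_UN_disjoint ballI impI)
      fix L L' assume L: "L \<in> S" "L' \<in> S" "L \<noteq> L'"
      then have "line L" "line L'" "v \<in> L" "v \<in> L'"
        using S(1) by auto
      then show "(L - {v}) \<inter> (L' - {v}) = {}"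
        using line_unique[of L L' v] L(3) by blast
    qed auto
    moreover have "(\<Sum>L\<in>S. k - l - 1) \<le> (\<Sum>L\<in>S. card (L - {v}))"
      using S(1) by (intro sum_mono) (auto simp: line_def)
    moreover have "card (\<Union>L\<in>S. L - {v}) \<le> card {y. X v y}"
      using S(1) by (intro card_mono) (auto simp: line_def is_clique_def)
    ultimately have "3 * (k - l - 1) \<le> k"
      by (simp add: S(2) deg)
    then show False
      using upper by simp
  qed
  define f where "f v x = (SOME L. line L \<and> v \<in> L \<and> x \<in> L)" for v x
  have f: "line (f v x)" "v \<in> f v x" "x \<in> f v x" if "X v x" for v x
    using someI_ex[OF line_through[OF that]] by (auto simp: f_def)
  let ?M = "common_neighbours X u w" and ?T = "{L. line L \<and> u \<in> L} \<times> {L. line L \<and> w \<in> L}"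
  \<comment> \<open>If \<open>x\<close> and \<open>y\<close> have the same image, the lines through
    \<open>u\<close> and \<open>w\<close> share both points and coincide, which makes
    \<open>u\<close> and \<open>w\<close> adjacent.\<close>
  have "inj_on (\<lambda>x. (f u x, f w x)) ?M"
  proof (rule inj_onI, rule ccontr)
    fix x y
    assume xy: "x \<in> ?M" "y \<in> ?M" "(f u x, f w x) = (f u y, f w y)" "x \<noteq> y"
    then have X: "X u x" "X u y" "X w x" "X w y"
      by (auto simp: common_neighbours_def)
    have "f u x = f w x"
      using line_unique[of "f u x" "f w x" x y] f[OF X(1)] f[OF X(2)] f[OF X(3)] f[OF X(4)] xy
      by auto
    then have "X u w"
      using f[OF X(1)] f[OF X(3)] uw(1) by (auto simp: line_def is_clique_def)
    with uw(2) show False ..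
  qed
  moreover have "(\<lambda>x. (f u x, f w x)) ` ?M \<subseteq> ?T"
    using f by (auto simp: common_neighbours_def)
  ultimately have "card ?M \<le> card ?T"
    by (intro card_inj_on_le) auto
  also have "\<dots> \<le> 2 * 2"
    unfolding card_cartesian_product by (intro mult_mono lines_at) auto
  finally show ?thesis by simp
qed

section \<open>Intersection numbers of association schemes\<close>

locale assoc_scheme =
  fixes r :: nat and c :: "'v::finite \<Rightarrow> 'v \<Rightarrow> nat"
  assumes scheme: "association_scheme r c"
begin

abbreviation p where "p \<equiv> intersection_number c"
abbreviation deg where "deg \<equiv> constituent_degree c"

definition A :: "nat \<Rightarrow> real ^ 'v ^ 'v" where
  "A i = (\<chi> u v. if c u v = i then 1 else 0)"

lemma c_less: "c u v < r"
proof -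
  have "(\<lambda>(u, v). c u v) (u, v) \<in> (\<lambda>(u, v). c u v) ` UNIV"
    by (rule imageI) simp
  then show ?thesis
    using scheme by (simp add: association_scheme_def)
qed

lemma c_surj: "t < r \<Longrightarrow> \<exists>u v. c u v = t"
proof -
  assume "t < r"
  then have "t \<in> (\<lambda>(u, v). c u v) ` UNIV"
    using scheme by (simp add: association_scheme_def)
  then show ?thesis by auto
qed

lemma c_eq_0_iff: "c u v = 0 \<longleftrightarrow> u = v"
  using scheme by (simp add: association_scheme_def)

lemma c_self [simp]: "c u u = 0"
  by (simp add: c_eq_0_iff)

lemma c_sym: "c u v = c v u"
  using scheme by (simp add: association_scheme_def)

lemma card_triangles:
  assumes "i < r" "j < r"
  shows "card {w. c u w = i \<and> c w v = j} = p (c u v) i j"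
proof -
  obtain q where q: "\<And>u' v'. c u' v' = c u v \<Longrightarrow> card {w. c u' w = i \<and> c w v' = j} = q"
  proof -
    have "\<forall>i<r. \<forall>j<r. \<forall>t<r. \<exists>q. \<forall>u v. c u v = t \<longrightarrow> card {w. c u w = i \<and> c w v = j} = q"
      using scheme unfolding association_scheme_def by blast
    with assms c_less[of u v] that show thesis
      by blast
  qed
  have "p (c u v) i j = q"
    unfolding intersection_number_def
    by (rule the_equality) (use q in blast)+
  then show ?thesis
    using q by simp
qed

lemma r_pos: "0 < r"
  using c_less[of undefined undefined] by simp

lemma card_sphere:
  assumes "i < r"
  shows "card {w. c u w = i} = deg i"
proof -
  have "{w. c u w = i} = {w. c u w = i \<and> c w u = i}"
    using c_sym by auto
  then show ?thesis
    using card_triangles[OF assms assms, of u u]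
    by (simp add: constituent_degree_def)
qed

lemma intersection_number_sym:
  assumes "i < r" "j < r" "t < r"
  shows "p t i j = p t j i"
proof -
  obtain u v where uv: "c u v = t"
    using c_surj assms(3) by blast
  have "{w. c u w = i \<and> c w v = j} = {w. c v w = j \<and> c w u = i}"
    using c_sym by auto
  then show ?thesis
    using card_triangles[OF assms(1,2), of u v] card_triangles[OF assms(2,1), of v u] uv c_sym[of u v]
    by simp
qed

lemma intersection_number_0:
  assumes "i < r" "t < r"
  shows "p t i 0 = (if i = t then 1 else 0)"
proof -
  obtain u v where uv: "c u v = t"
    using c_surj assms(2) by blast
  have "{w. c u w = i \<and> c w v = 0} = (if i = t then {v} else {})"
    using uv by (auto simp: c_eq_0_iff)
  then show ?thesis
    using card_triangles[OF assms(1) r_pos, of u v] uv by (simp split: if_splits)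
qed

lemma sum_intersection_numbers:
  assumes "i < r" "t < r"
  shows "(\<Sum>j<r. p t i j) = deg i"
proof -
  obtain u v where uv: "c u v = t"
    using c_surj assms(2) by blast
  have "{w. c u w = i} = (\<Union>j<r. {w. c u w = i \<and> c w v = j})"
    using c_less by auto
  then have "deg i = card (\<Union>j<r. {w. c u w = i \<and> c w v = j})"
    using card_sphere[OF assms(1), of u] by simp
  also have "\<dots> = (\<Sum>j<r. card {w. c u w = i \<and> c w v = j})"
    by (rule card_UN_disjoint) auto
  also have "\<dots> = (\<Sum>j<r. p t i j)"
    using card_triangles[OF assms(1), of _ u v] uv by (intro sum.cong) auto
  finally show ?thesis ..
qed

text \<open>Both sides count the pairs \<open>(v, w)\<close> with \<open>c u v = t\<close>, \<open>c u w = i\<close> and \<open>c w v = j\<close> for a fixed \<open>u\<close>.\<close>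

lemma deg_mult_intersection_number:
  assumes "i < r" "j < r" "t < r"
  shows "deg t * p t i j = deg i * p i t j"
proof -
  define u where "u = (undefined :: 'v)"
  have count: "card {(v, w). c u v = t' \<and> c u w = i' \<and> c w v = j} = deg t' * p t' i' j"
    if "t' < r" "i' < r" for t' i'
  proof -
    have "{(v, w). c u v = t' \<and> c u w = i' \<and> c w v = j}
        = (SIGMA v:{v. c u v = t'}. {w. c u w = i' \<and> c w v = j})"
      by auto
    then have "card {(v, w). c u v = t' \<and> c u w = i' \<and> c w v = j}
        = (\<Sum>v | c u v = t'. card {w. c u w = i' \<and> c w v = j})"
      by simp
    also have "\<dots> = (\<Sum>v | c u v = t'. p t' i' j)"
      using card_triangles[OF that(2) assms(2), of u] by (intro sum.cong) auto
    finally show ?thesis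
      by (simp add: card_sphere[OF that(1)])
  qed
  have "{(v, w). c u v = t \<and> c u w = i \<and> c w v = j}
      = prod.swap ` {(v, w). c u v = i \<and> c u w = t \<and> c w v = j}"
    using c_sym by (auto simp: image_iff)
  then have "card {(v, w). c u v = t \<and> c u w = i \<and> c w v = j}
      = card {(v, w). c u v = i \<and> c u w = t \<and> c w v = j}"
    by (simp add: card_image)
  then show ?thesis
    by (simp add: count assms)
qed

lemma deg_pos:
  assumes "i < r"
  shows "0 < deg i"
proof -
  obtain u v where "c u v = i"
    using c_surj assms by blast
  then have "{w. c u w = i} \<noteq> {}"
    by blast
  then have "0 < card {w. c u w = i}"
    by (simp add: card_gt_0_iff)
  then show ?thesis
    by (simp add: card_sphere[OF assms])
qed

section \<open>The Bose-Mesner algebra and its action on vectors\<close>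

lemma A_mult_component: "(A i ** A j) $ u $ v = real (card {w. c u w = i \<and> c w v = j})"
proof -
  have "(A i ** A j) $ u $ v = (\<Sum>w\<in>UNIV. if c u w = i \<and> c w v = j then 1 else 0)"
    unfolding matrix_matrix_mult_def A_def vec_lambda_beta by (intro sum.cong) auto
  then show ?thesis
    by (simp add: sum.If_cases)
qed

lemma A_mult:
  assumes "i < r" "j < r"
  shows "A i ** A j = (\<Sum>t<r. real (p t i j) *\<^sub>R A t)"
proof -
  have "(\<Sum>t<r. real (p t i j) *\<^sub>R A t) $ u $ v = (\<Sum>t<r. if c u v = t then real (p t i j) else 0)" for u v
    by (simp add: A_def if_distrib cong: if_cong)
  then show ?thesis
    using c_less by (simp add: vec_eq_iff A_mult_component card_triangles assms)
qed

lemma A_0: "A 0 = mat 1"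
  by (simp add: A_def mat_def c_eq_0_iff)

lemma A_mult_vec:
  assumes "i < r" "j < r"
  shows "A i *v (A j *v x) = (\<Sum>t<r. real (p t i j) *\<^sub>R (A t *v x))"
proof -
  have scale: "(a *\<^sub>R M) *v x = a *\<^sub>R (M *v x)" for a :: real and M :: "real ^ 'v ^ 'v"
    by (simp add: vec_eq_iff matrix_vector_mult_def sum_distrib_left mult.assoc)
  have sum: "(\<Sum>t\<in>T. M t) *v x = (\<Sum>t\<in>T. M t *v x)" if "finite T" for T :: "nat set" and M
    using that by induction (simp_all add: matrix_vector_mult_add_rdistrib)
  show ?thesis
    unfolding matrix_vector_mul_assoc A_mult[OF assms] by (simp add: sum scale)
qed

text \<open>The matrices \<open>A t\<close> sum to the all-ones matrix, which kills vectors of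
  weight zero.\<close>

lemma sum_A_vec:
  assumes "(\<Sum>u\<in>UNIV. x $ u) = 0"
  shows "(\<Sum>t<r. A t *v x) = 0"
proof -
  have "(\<Sum>t<r. A t *v x) $ u = (\<Sum>w\<in>UNIV. \<Sum>t<r. if c u w = t then x $ w else 0)" for u
    unfolding A_def matrix_vector_mult_def
    by (subst sum.swap) (simp add: if_distribR if_distrib cong: if_cong)
  then show ?thesis
    using assms c_less by (simp add: vec_eq_iff)
qed

text \<open>Every column of \<open>A i\<close> sums to \<open>deg i\<close>. In particular
  \<open>A i\<close> preserves weight zero.\<close>

lemma sum_A_vec_component:
  assumes "i < r"
  shows "(\<Sum>u\<in>UNIV. (A i *v x) $ u) = deg i * (\<Sum>u\<in>UNIV. x $ u)"
proof -
  have col: "(\<Sum>u\<in>UNIV. if c u w = i then x $ w else 0) = deg i * x $ w" for w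
    using card_sphere[OF assms, of w] c_sym[of w] by (simp add: sum.If_cases)
  have "(\<Sum>u\<in>UNIV. (A i *v x) $ u) = (\<Sum>w\<in>UNIV. \<Sum>u\<in>UNIV. if c u w = i then x $ w else 0)"
    unfolding A_def matrix_vector_mult_def
    by (simp add: if_distribR if_distrib cong: if_cong) (rule sum.swap)
  then show ?thesis
    by (simp add: col sum_distrib_left)
qed

text \<open>Both sides are an entry of \<open>A i ** A j ** A l\<close>, bracketed in two
  ways.\<close>

lemma intersection_numbers_assoc:
  assumes "i < r" "j < r" "l < r" "s < r"
  shows "(\<Sum>t<r. p t i j * p s t l) = (\<Sum>t<r. p t j l * p s i t)"
proof -
  obtain u v where uv: "c u v = s"
    using c_surj assms(4) by blast
  have scale: "((a *\<^sub>R M) ** N) $ u $ v = a * (M ** N) $ u $ v" "(N ** (a *\<^sub>R M)) $ u $ v = a * (N ** M) $ u $ v"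
    for a :: real and M N :: "real ^ 'v ^ 'v"
    by (simp_all add: matrix_matrix_mult_def sum_distrib_left mult_ac)
  have distrib: "(M + M') ** N = M ** N + M' ** N" for M M' N :: "real ^ 'v ^ 'v"
    by (simp add: matrix_matrix_mult_def vec_eq_iff distrib_right sum.distrib)
  have zero: "0 ** N = 0" "N ** 0 = 0" for N :: "real ^ 'v ^ 'v"
    by (simp_all add: matrix_matrix_mult_def vec_eq_iff)
  have suml: "(\<Sum>t\<in>T. M t) ** N = (\<Sum>t\<in>T. M t ** N)"
    if "finite T" for T :: "nat set" and M :: "nat \<Rightarrow> real ^ 'v ^ 'v" and N :: "real ^ 'v ^ 'v"
    using that by induction (simp_all add: distrib zero)
  have sumr: "N ** (\<Sum>t\<in>T. M t) = (\<Sum>t\<in>T. N ** M t)"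
    if "finite T" for T :: "nat set" and M :: "nat \<Rightarrow> real ^ 'v ^ 'v" and N :: "real ^ 'v ^ 'v"
    using that by induction (simp_all add: matrix_add_ldistrib zero)
  have "real (\<Sum>t<r. p t i j * p s t l) = ((A i ** A j) ** A l) $ u $ v"
    using assms uv
    by (simp add: A_mult[OF assms(1,2)] suml scale A_mult_component card_triangles)
  also have "\<dots> = (A i ** (A j ** A l)) $ u $ v"
    by (simp add: matrix_mul_assoc)
  also have "\<dots> = real (\<Sum>t<r. p t j l * p s i t)"
    using assms uv
    by (simp add: A_mult[OF assms(2,3)] sumr scale A_mult_component card_triangles)
  finally show ?thesis
    by (simp only: of_nat_eq_iff)
qed

lemma adjacency_matrix_constituent: "0 < i \<Longrightarrow> adjacency_matrix (constituent c i) = A i"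
  by (auto simp: adjacency_matrix_def A_def constituent_def vec_eq_iff c_eq_0_iff[symmetric])

lemma regular_constituent: "0 < i \<Longrightarrow> i < r \<Longrightarrow> regular_graph (constituent c i) (deg i)"
proof -
  assume "0 < i" "i < r"
  then have "{v. constituent c i u v} = {v. c u v = i}" for u
    by (auto simp: constituent_def)
  then show ?thesis
    using card_sphere[OF \<open>i < r\<close>] by (simp add: regular_graph_def)
qed

lemma card_common_neighbours_constituent:
  assumes "0 < i" "i < r"
  shows "card (common_neighbours (constituent c i) u v) = p (c u v) i i"
proof -
  have "common_neighbours (constituent c i) u v = {w. c u w = i \<and> c w v = i}"
    using assms(1) c_sym by (auto simp: common_neighbours_def constituent_def)
  then show ?thesis
    using card_triangles[OF assms(2,2)] by simp
qed

end

section \<open>Rank 4 schemes with a strongly regular first constituent\<close>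

text \<open>\<open>deg_2_le_3\<close> is the hypothesis \<open>k_2 \<le> \<epsilon> k_3 / 2\<close>
  cleared of denominators.\<close>

locale srg_scheme = assoc_scheme 4 c for c :: "'v::finite \<Rightarrow> 'v \<Rightarrow> nat" +
  fixes k l m :: nat
  assumes srg: "strongly_regular_graph (constituent c 1) k l m"
    and smallest: "smallest_eigenvalue (constituent c 1) = - 2"
    and diam: "scheme_diameter_2 4 c"
    and deg_1_le_2: "deg 1 \<le> deg 2"
    and deg_2_le_3: "2 * 10 ^ 26 * deg 2 \<le> deg 3"
begin

abbreviation b where "b \<equiv> p 1 1 2"

text \<open>The eigenvalues of \<open>A 1\<close> on vectors of weight zero are \<open>R\<close> and \<open>- 2\<close>.\<close>

definition R :: real where "R = real l - real m + 2"

section \<open>Intersection numbers in terms of \<open>R\<close>, \<open>m\<close> and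
  \<open>b\<close>\<close>

lemma sum_less_4: "(\<Sum>t<4. f t) = f 0 + f 1 + f 2 + f (3::nat)"
  for f :: "nat \<Rightarrow> 'a::comm_monoid_add"
  by (simp add: numeral_eq_Suc)

lemma p_11: "p 1 1 1 = l" "p 2 1 1 = m" "p 3 1 1 = m"
proof -
  have eq: "card (common_neighbours (constituent c 1) u v) = p (c u v) 1 1" for u v
    by (rule card_common_neighbours_constituent) auto
  obtain u v where uv: "c u v = 1" using c_surj[of 1] by auto
  then have "constituent c 1 u v"
    by (auto simp: constituent_def)
  then show "p 1 1 1 = l"
    using srg eq[of u v] uv by (simp add: strongly_regular_graph_def)
  have "p t 1 1 = m" if t: "t < 4" "t \<noteq> 0" "t \<noteq> 1" for t
  proof -
    obtain u v where uv: "c u v = t" using c_surj[of t] t by auto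
    then have "u \<noteq> v \<and> \<not> constituent c 1 u v"
      using t by (auto simp: constituent_def)
    then show ?thesis
      using srg eq[of u v] uv by (simp add: strongly_regular_graph_def)
  qed
  from this[of 2] this[of 3] show "p 2 1 1 = m" "p 3 1 1 = m" by auto
qed

text \<open>Vertices at colour 3 are nonadjacent in constituent \<open>i\<close>, whose diameter is
  at most 2, so they have a common neighbour.\<close>

lemma p_pos:
  assumes "i \<in> {1, 2}"
  shows "1 \<le> p 3 i i"
proof -
  obtain u v where uv: "c u v = 3" using c_surj[of 3] by auto
  have "graph_diameter (constituent c i) \<le> 2"
    using diam assms by (auto simp: scheme_diameter_2_def)
  moreover have "u \<noteq> v" "\<not> constituent c i u v"
    using uv assms by (auto simp: constituent_def)
  ultimately obtain w where "constituent c i u w \<and> constituent c i w v"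
    using graph_diameter_le_2D[of "constituent c i" u v] by auto
  then have "{w. c u w = i \<and> c w v = i} \<noteq> {}"
    by (auto simp: constituent_def)
  then have "0 < card {w. c u w = i \<and> c w v = i}"
    by (simp add: card_gt_0_iff)
  then show ?thesis
    using card_triangles[of i i u v] uv assms by auto
qed

lemma m_pos: "1 \<le> m"
  using p_pos[of 1] p_11 by simp

lemma row_sums:
  "1 + l + b + p 1 1 3 = deg 1"
  "m + p 2 1 2 + p 2 1 3 = deg 1"
  "m + p 3 1 2 + p 3 1 3 = deg 1"
  "1 + p 2 1 2 + p 2 2 2 + p 2 2 3 = deg 2"
  "p 3 1 2 + p 3 2 2 + p 3 2 3 = deg 2"
  using sum_intersection_numbers[of 1 1] sum_intersection_numbers[of 1 2]
    sum_intersection_numbers[of 1 3] sum_intersection_numbers[of 2 2]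
    sum_intersection_numbers[of 2 3] intersection_number_sym[of 2 1 2] intersection_number_sym[of 2 1 3]
  by (simp_all add: sum_less_4 intersection_number_0 p_11[simplified])

lemma edge_counts:
  "deg 1 * b = deg 2 * m"
  "deg 1 * p 1 1 3 = deg 3 * m"
  "deg 2 * p 2 1 3 = deg 3 * p 3 1 2"
  "deg 1 * p 1 2 2 = deg 2 * p 2 1 2"
  "deg 3 * p 3 2 2 = deg 2 * p 2 2 3"
  using deg_mult_intersection_number[of 2 1 1] deg_mult_intersection_number[of 3 1 1]
    deg_mult_intersection_number[of 3 1 2] deg_mult_intersection_number[of 2 2 1]
    deg_mult_intersection_number[of 2 2 3] intersection_number_sym[of 2 1 1]
    intersection_number_sym[of 3 1 1] intersection_number_sym[of 3 1 2] intersection_number_sym[of 2 1 3]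
    intersection_number_sym[of 3 2 2]
  by (simp_all add: p_11[simplified])

text \<open>The multiplication table of the Bose-Mesner algebra on weight zero, where
  \<open>A 3\<close> can be eliminated; the second equation is the quadratic of a strongly regular
  graph.\<close>

lemma A_vec:
  assumes "(\<Sum>u\<in>UNIV. x $ u) = 0"
  shows "A 3 *v x = - x - A 1 *v x - A 2 *v x"
    and "A 1 *v (A 1 *v x) = (R - 2) *\<^sub>R (A 1 *v x) + (real (deg 1) - real m) *\<^sub>R x"
    and "A 1 *v (A 2 *v x) = real b *\<^sub>R (A 1 *v x) + real (p 2 1 2) *\<^sub>R (A 2 *v x) + real (p 3 1 2) *\<^sub>R (A 3 *v x)"
    and "A 2 *v (A 1 *v x) = A 1 *v (A 2 *v x)"
    and "A 2 *v (A 2 *v x) = real (deg 2) *\<^sub>R x + real (p 1 2 2) *\<^sub>R (A 1 *v x) + real (p 2 2 2) *\<^sub>R (A 2 *v x)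
      + real (p 3 2 2) *\<^sub>R (A 3 *v x)"
proof -
  \<comment> \<open>\<open>p 0 1 1 = deg 1\<close> already exhausts the row sum.\<close>
  have p0: "p 0 1 2 = 0"
    using sum_intersection_numbers[of 1 0] deg_pos[of 1]
    by (simp add: sum_less_4 constituent_degree_def)
  show A3: "A 3 *v x = - x - A 1 *v x - A 2 *v x"
  proof -
    have "x + A 1 *v x + A 2 *v x + A 3 *v x = 0"
      using sum_A_vec[OF assms] by (simp add: sum_less_4 A_0)
    then have "A 3 *v x = - (x + A 1 *v x + A 2 *v x)"
      by (rule minus_unique[symmetric])
    then show ?thesis
      by simp
  qed
  have "A 1 *v (A 1 *v x) = real (deg 1) *\<^sub>R x + real l *\<^sub>R (A 1 *v x) + real m *\<^sub>R (A 2 *v x) + real m *\<^sub>R (A 3 *v x)"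
    using A_mult_vec[of 1 1 x] by (simp add: sum_less_4 A_0 p_11[simplified] constituent_degree_def)
  then show "A 1 *v (A 1 *v x) = (R - 2) *\<^sub>R (A 1 *v x) + (real (deg 1) - real m) *\<^sub>R x"
    by (simp add: A3 R_def algebra_simps)
  show A12: "A 1 *v (A 2 *v x) = real b *\<^sub>R (A 1 *v x) + real (p 2 1 2) *\<^sub>R (A 2 *v x) + real (p 3 1 2) *\<^sub>R (A 3 *v x)"
    using A_mult_vec[of 1 2 x] p0 by (simp add: sum_less_4)
  show "A 2 *v (A 1 *v x) = A 1 *v (A 2 *v x)"
  proof -
    have "(\<Sum>t<4. real (p t 2 1) *\<^sub>R (A t *v x)) = (\<Sum>t<4. real (p t 1 2) *\<^sub>R (A t *v x))"
      by (intro sum.cong refl, subst intersection_number_sym) auto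
    then show ?thesis
      using A_mult_vec[of 1 2 x] A_mult_vec[of 2 1 x] by simp
  qed
  show "A 2 *v (A 2 *v x) = real (deg 2) *\<^sub>R x + real (p 1 2 2) *\<^sub>R (A 1 *v x) + real (p 2 2 2) *\<^sub>R (A 2 *v x)
      + real (p 3 2 2) *\<^sub>R (A 3 *v x)"
    using A_mult_vec[of 2 2 x] by (simp add: sum_less_4 A_0 constituent_degree_def)
qed

lemma eigenvector_minus_2: "\<exists>x. x \<noteq> 0 \<and> (\<Sum>u\<in>UNIV. x $ u) = 0 \<and> A 1 *v x = - 2 *\<^sub>R x"
proof -
  let ?X = "constituent c 1"
  \<comment> \<open>\<open>last\<close> says nothing about an empty list, so an eigenvalue is
    exhibited first: the degree, with the all-ones vector.\<close>
  have "A 1 *v 1 = real (deg 1) *\<^sub>R 1"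
    using card_sphere[of 1] by (simp add: A_def matrix_vector_mult_def vec_eq_iff sum.If_cases)
  then have "real (deg 1) \<in> set (graph_eigenvalues ?X)"
    unfolding set_graph_eigenvalues by (auto simp: adjacency_matrix_constituent intro!: exI[of _ 1])
  then have "graph_eigenvalues ?X \<noteq> []"
    by auto
  then have "- 2 \<in> set (graph_eigenvalues ?X)"
    using smallest unfolding smallest_eigenvalue_def by (metis last_in_set)
  then obtain x where x: "x \<noteq> 0" "A 1 *v x = - 2 *\<^sub>R x"
    unfolding set_graph_eigenvalues by (auto simp: adjacency_matrix_constituent)
  \<comment> \<open>The weight of \<open>x\<close> is scaled by \<open>deg 1\<close> and by
    \<open>- 2\<close> alike, so it vanishes.\<close>
  have "real (deg 1) * (\<Sum>u\<in>UNIV. x $ u) = - 2 * (\<Sum>u\<in>UNIV. x $ u)"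
    using sum_A_vec_component[of 1 x] unfolding x(2) by (simp add: sum_distrib_left)
  then have "(real (deg 1) + 2) * (\<Sum>u\<in>UNIV. x $ u) = 0"
    by (simp add: algebra_simps)
  then have "(\<Sum>u\<in>UNIV. x $ u) = 0"
    by (simp add: add_nonneg_eq_0_iff)
  with x show ?thesis by blast
qed

text \<open>\<open>- 2\<close> is a root of the quadratic for \<open>A 1\<close>; this makes
  \<open>R\<close> the other root.\<close>

lemma deg_1_eq: "real (deg 1) = 2 * R + real m"
proof -
  obtain x where x: "x \<noteq> 0" "(\<Sum>u\<in>UNIV. x $ u) = 0" "A 1 *v x = - 2 *\<^sub>R x"
    using eigenvector_minus_2 by blast
  have "A 1 *v (A 1 *v x) = 4 *\<^sub>R x"
    unfolding x(3) matrix_vector_mult_scaleR by simp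
  then have "(4 - (real (deg 1) - real m - 2 * (R - 2))) *\<^sub>R x = 0"
    using A_vec(2)[OF x(2)] unfolding x(3) by (simp add: algebra_simps)
  then show ?thesis
    using x(1) by simp
qed

lemma l_eq: "real l = R + real m - 2"
  by (simp add: R_def)

text \<open>By \<open>edge_counts\<close>, \<open>b\<close> and \<open>p 1 1 3\<close> are
  proportional to \<open>deg 2\<close> and \<open>deg 3\<close>; by the first row sum they add up to
  \<open>R + 1\<close>.\<close>

lemma b_eq: "real b * (real (deg 2) + real (deg 3)) = (R + 1) * real (deg 2)"
proof -
  have s: "real b + real (p 1 1 3) = R + 1"
    using arg_cong[OF row_sums(1), of real] deg_1_eq l_eq by simp
  have e: "real (deg 1) * real b = real (deg 2) * real m" "real (deg 1) * real (p 1 1 3) = real (deg 3) * real m"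
    using edge_counts(1,2) by (metis of_nat_mult)+
  have "real (deg 1) * (real b * (real (deg 2) + real (deg 3))) = real (deg 2) * (real (deg 2) * real m + real (deg 3) * real m)"
    using e(1) by algebra
  also have "\<dots> = real (deg 1) * (real (deg 2) * (real b + real (p 1 1 3)))"
    unfolding e[symmetric] by (simp add: algebra_simps)
  also have "\<dots> = real (deg 1) * ((R + 1) * real (deg 2))"
    unfolding s by simp
  finally show ?thesis
    using deg_pos[of 1] by simp
qed

text \<open>
  Comparing the coefficients of \<open>A 2\<close> and \<open>A 3\<close> in \<open>A 1 (A 1 A 2) = (A 1 A 1) A 2\<close> shows that
  \<open>p 2 1 2 - p 3 1 2\<close> is \<open>R\<close> or \<open>- 2\<close>, according to which eigenspace of \<open>A 1\<close> is split by \<open>A 2\<close>.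
  In the first case \<open>deg 2 / (deg 2 + deg 3) = b - p 3 1 2\<close> would be an integer.
\<close>

lemma p_12: "real (p 3 1 2) = 2 * real b" "real (p 2 1 2) = 2 * real b - 2"
proof -
  define a2 a3 k2 k3 where "a2 = real (p 2 1 2)" and "a3 = real (p 3 1 2)"
    and "k2 = real (deg 2)" and "k3 = real (deg 3)"
  have k23: "0 < k2" "0 < k3"
    using deg_pos[of 2] deg_pos[of 3] by (simp_all add: k2_def k3_def)
  have "deg 1 + l * p 2 1 2 + m * p 2 2 2 + m * p 2 2 3
      = b * m + p 2 1 2 * p 2 1 2 + p 3 1 2 * p 2 1 3"
    using intersection_numbers_assoc[of 1 1 2 2] intersection_number_sym[of 0 2 2] intersection_number_sym[of 3 2 2]
    by (simp add: sum_less_4 p_11[simplified] intersection_number_0 constituent_degree_def)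
  moreover have "l * p 3 1 2 + m * p 3 2 2 + m * p 3 2 3
      = b * m + p 2 1 2 * p 3 1 2 + p 3 1 2 * p 3 1 3"
    using intersection_numbers_assoc[of 1 1 2 3] intersection_number_sym[of 0 2 3] intersection_number_sym[of 3 2 3]
    by (simp add: sum_less_4 p_11[simplified] intersection_number_0 constituent_degree_def)
  ultimately have E:
    "real (deg 1) + real l * a2 + real m * (real (p 2 2 2) + real (p 2 2 3)) = b * m + a2 * a2 + a3 * real (p 2 1 3)"
    "real l * a3 + real m * (real (p 3 2 2) + real (p 3 2 3)) = b * m + a2 * a3 + a3 * real (p 3 1 3)"
    unfolding a2_def a3_def by (simp_all add: algebra_simps flip: of_nat_mult of_nat_add)
  have S: "real (p 2 2 2) + real (p 2 2 3) = k2 - 1 - a2" "real (p 3 2 2) + real (p 3 2 3) = k2 - a3"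
    "real (p 2 1 3) = real (deg 1) - real m - a2" "real (p 3 1 3) = real (deg 1) - real m - a3"
    using row_sums(2-5)[THEN arg_cong[of _ _ real]] by (simp_all add: a2_def a3_def k2_def)
  \<comment> \<open>The difference of the two identities is the quadratic for \<open>A 1\<close>,
    evaluated at \<open>a2 - a3\<close>.\<close>
  have "(a2 - a3 - R) * (a2 - a3 + 2) = 0"
    using E unfolding S deg_1_eq l_eq by algebra
  then consider "a2 = a3 + R" | "a3 = a2 + 2"
    by fastforce
  moreover have split: "k2 * (2 * R - a2) = k3 * a3"
    using edge_counts(3)[THEN arg_cong[of _ _ real]] S(3) deg_1_eq by (simp add: k2_def k3_def a3_def)
  have b: "real b * (k2 + k3) = (R + 1) * k2"
    using b_eq by (simp add: k2_def k3_def)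
  ultimately have "a3 = a2 + 2"
  proof cases
    case 1
    have "(real b - a3) * (k2 + k3) = k2"
      using split b unfolding 1 by algebra
    then have "real_of_int ((int b - int (p 3 1 2)) * (int (deg 2) + int (deg 3))) = real_of_int (int (deg 2))"
      by (simp add: a3_def k2_def k3_def)
    then have "(int b - int (p 3 1 2)) * (int (deg 2) + int (deg 3)) = int (deg 2)"
      by (simp only: of_int_eq_iff)
    then have "int (deg 2) + int (deg 3) dvd int (deg 2)"
      by (metis dvd_triv_right)
    then have "int (deg 2) + int (deg 3) \<le> int (deg 2)"
      using deg_pos[of 2] by (intro zdvd_imp_le) auto
    then show ?thesis
      using deg_pos[of 3] by simp
  qed
  \<comment> \<open>\<open>split\<close> now reads \<open>a3 * (k2 + k3) = 2 * (R + 1) * k2\<close>,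
    twice the equation for \<open>b\<close>.\<close>
  then have "(a3 - 2 * real b) * (k2 + k3) = 0"
    using split b by algebra
  then show "real (p 3 1 2) = 2 * real b"
    using k23 by (simp add: a3_def)
  then show "real (p 2 1 2) = 2 * real b - 2"
    using \<open>a3 = a2 + 2\<close> by (simp add: a2_def a3_def)
qed

text \<open>\<open>b_eq\<close> and \<open>N * k2 \<le> k3\<close> give
  \<open>b * (N + 1) \<le> R + 1\<close>. Since \<open>1 \<le> b\<close>, \<open>R\<close> is huge,
  and double counting carries the smallness of \<open>b\<close> over to \<open>m\<close> and
  \<open>p 1 2 2\<close>; \<open>p 3 2 2\<close> is small because \<open>deg 3\<close> outweighs
  \<open>deg 2\<close>.\<close>

lemma size_bounds:
  "2 * 10 ^ 26 \<le> R" "2 * 10 ^ 26 * real m \<le> real (deg 1)" "2 * 10 ^ 26 * real b \<le> real (deg 2)"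
  "2 * 10 ^ 26 * real (p 1 2 2) \<le> real (deg 2)" "2 * 10 ^ 26 * real (p 3 2 2) \<le> real (deg 2)"
proof -
  define N :: real where "N = 2 * 10 ^ 26"
  define k1 k2 k3 where "k1 = real (deg 1)" and "k2 = real (deg 2)" and "k3 = real (deg 3)"
  have pos: "0 < k1" "0 < k2" "0 < k3" "0 < N" "1 \<le> real m"
    using deg_pos m_pos by (simp_all add: k1_def k2_def k3_def N_def)
  have Nk2: "N * k2 \<le> k3"
    using deg_2_le_3 unfolding N_def k2_def k3_def
    by (metis (mono_tags) of_nat_le_iff of_nat_mult of_nat_numeral of_nat_power)
  have k12: "k1 \<le> k2"
    using deg_1_le_2 by (simp add: k1_def k2_def)
  have k1b: "k1 * real b = k2 * real m"
    using edge_counts(1)[THEN arg_cong[of _ _ real]] by (simp add: k1_def k2_def)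
  have k1: "k1 = 2 * R + real m"
    using deg_1_eq by (simp add: k1_def)
  have "b \<noteq> 0"
    using k1b pos by (intro notI) simp
  then have "1 \<le> real b"
    by simp
  have bN: "real b * (N + 1) \<le> R + 1"
  proof -
    have "real b * (N + 1) * k2 = real b * (k2 + N * k2)"
      by (simp add: algebra_simps)
    also have "\<dots> \<le> real b * (k2 + k3)"
      using Nk2 by (intro mult_left_mono) auto
    also have "\<dots> = (R + 1) * k2"
      using b_eq by (simp add: k2_def k3_def)
    finally show ?thesis
      using pos by simp
  qed
  have "1 * (N + 1) \<le> real b * (N + 1)"
    using \<open>1 \<le> real b\<close> pos by (intro mult_right_mono) auto
  then have RN: "N \<le> R"
    using bN by simp
  have mb: "real m \<le> real b"
  proof -
    have "k1 * real m \<le> k1 * real b"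
      unfolding k1b using k12 by (intro mult_right_mono) auto
    then show ?thesis
      using pos by simp
  qed
  have bN': "N * real b \<le> R + 1"
    using bN \<open>1 \<le> real b\<close> by (simp add: algebra_simps)
  have "N * real m \<le> N * real b"
    using mb pos by simp
  then have mN: "N * real m \<le> k1"
    using bN' pos RN unfolding k1 by (simp add: N_def)
  have kb: "N * real b \<le> k2"
    using bN' k12 pos RN unfolding k1 by (simp add: N_def)
  have kp: "N * real (p 1 2 2) \<le> k2"
  proof -
    have "k1 * real (p 1 2 2) = k2 * (2 * real b - 2)"
      using edge_counts(4)[THEN arg_cong[of _ _ real]] p_12(2) by (simp add: k1_def k2_def)
    then have "k1 * (N * real (p 1 2 2)) = k2 * (2 * (N * real b) - 2 * N)"
      by algebra
    also have "\<dots> \<le> k2 * k1"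
      using bN' pos RN by (intro mult_left_mono) (simp_all add: k1 N_def)
    finally show ?thesis
      using pos by simp
  qed
  have kmu: "N * real (p 3 2 2) \<le> k2"
  proof -
    have "k2 * (N * real (p 3 2 2)) = N * k2 * real (p 3 2 2)"
      by simp
    also have "\<dots> \<le> k3 * real (p 3 2 2)"
      using Nk2 by (intro mult_right_mono) auto
    also have "\<dots> = k2 * real (p 2 2 3)"
      using edge_counts(5)[THEN arg_cong[of _ _ real]] by (simp add: k2_def k3_def)
    also have "\<dots> \<le> k2 * k2"
      using row_sums(4) by (intro mult_left_mono) (simp_all add: k2_def)
    finally show ?thesis
      using pos by simp
  qed
  show "2 * 10 ^ 26 \<le> R" "2 * 10 ^ 26 * real m \<le> real (deg 1)" "2 * 10 ^ 26 * real b \<le> real (deg 2)"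
    "2 * 10 ^ 26 * real (p 1 2 2) \<le> real (deg 2)" "2 * 10 ^ 26 * real (p 3 2 2) \<le> real (deg 2)"
    using RN mN kb kp kmu unfolding N_def k1_def k2_def by auto
qed

section \<open>Eigenvalues of \<open>A 2\<close> and \<open>A 1 + A 2\<close> on weight zero\<close>

definition S :: real where "S = real (p 2 2 2) - real (p 3 2 2)"

definition D :: real where "D = real (deg 2) - 2 * real (p 1 2 2) + real (p 3 2 2)"

text \<open>So \<open>S\<close> and \<open>- D\<close> are the sum and the product of the two
  candidate eigenvalues of \<open>A 2\<close> on this eigenspace.\<close>

lemma A_2_square:
  assumes "(\<Sum>u\<in>UNIV. x $ u) = 0" "A 1 *v x = - 2 *\<^sub>R x"
  shows "A 2 *v (A 2 *v x) = S *\<^sub>R (A 2 *v x) + D *\<^sub>R x"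
proof -
  have A3: "A 3 *v x = x - A 2 *v x"
    unfolding A_vec(1)[OF assms(1)] assms(2) by (simp add: scaleR_2)
  show ?thesis
    unfolding A_vec(5)[OF assms(1)] A3 assms(2) by (simp add: S_def D_def algebra_simps)
qed

text \<open>It is applied to \<open>X_2\<close> with \<open>s = 0\<close> and to
  \<open>X_{1,2}\<close> with \<open>s = 1\<close>. If \<open>x\<close> is outside the eigenspace of
  \<open>- 2\<close>, its image under \<open>A 1 + 2\<close> is a nonzero
  \<open>R\<close>-eigenvector of \<open>A 1\<close> with the same \<open>a\<close>, and there
  \<open>A 2\<close> acts as \<open>- b\<close>.\<close>

lemma eigenvalue_cases:
  assumes x: "x \<noteq> 0" "(\<Sum>u\<in>UNIV. x $ u) = 0" and eig: "s *\<^sub>R (A 1 *v x) + A 2 *v x = a *\<^sub>R x"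
  shows "a = s * R - real b \<or> (a + 2 * s)\<^sup>2 = S * (a + 2 * s) + D"
proof (cases "A 1 *v x = - 2 *\<^sub>R x")
  case True
  define h where "h = a + 2 * s"
  have A2: "A 2 *v x = h *\<^sub>R x"
    using eig unfolding True h_def by (simp add: algebra_simps)
  have "A 2 *v (A 2 *v x) = h\<^sup>2 *\<^sub>R x"
    unfolding A2 matrix_vector_mult_scaleR by (simp add: power2_eq_square)
  then have "(h\<^sup>2 - (S * h + D)) *\<^sub>R x = 0"
    using A_2_square[OF x(2) True] unfolding A2 by (simp add: algebra_simps)
  then show ?thesis
    using x(1) by (simp add: h_def)
next
  case False
  define y where "y = A 1 *v x + 2 *\<^sub>R x"
  define h where "h = a - s * R"
  have y0: "y \<noteq> 0"
    using False by (simp add: y_def add_eq_0_iff2)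
  have ysum: "(\<Sum>u\<in>UNIV. y $ u) = 0"
    using sum_A_vec_component[of 1 x] x(2)
    by (simp add: y_def sum.distrib flip: sum_distrib_left)
  have A1y: "A 1 *v y = R *\<^sub>R y"
    using A_vec(2)[OF x(2)] deg_1_eq
    by (simp add: y_def matrix_vector_right_distrib matrix_vector_mult_scaleR algebra_simps)
  have A2x: "A 2 *v x = a *\<^sub>R x - s *\<^sub>R (A 1 *v x)"
    using eig by (simp add: algebra_simps)
  have "A 2 *v y = A 1 *v (A 2 *v x) + 2 *\<^sub>R (A 2 *v x)"
    using A_vec(4)[OF x(2)] by (simp add: y_def matrix_vector_right_distrib matrix_vector_mult_scaleR)
  also have "\<dots> = a *\<^sub>R y - s *\<^sub>R (A 1 *v y)"
    unfolding A2x y_def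
    by (simp add: matrix_vector_right_distrib matrix_vector_mult_diff_distrib matrix_vector_mult_scaleR algebra_simps)
  finally have A2y: "A 2 *v y = h *\<^sub>R y"
    unfolding A1y by (simp add: h_def algebra_simps)
  have "A 1 *v (A 2 *v y) = (h * R) *\<^sub>R y"
    unfolding A2y matrix_vector_mult_scaleR A1y by simp
  then have "(h * R - (real b * R + real (p 2 1 2) * h - real (p 3 1 2) * (1 + R + h))) *\<^sub>R y = 0"
    using A_vec(3)[OF ysum] unfolding A_vec(1)[OF ysum] A1y A2y by (simp add: algebra_simps)
  then have "h * R = real b * R + real (p 2 1 2) * h - real (p 3 1 2) * (1 + R + h)"
    using y0 by simp
  then have "(R + 2) * (h + real b) = 0"
    unfolding p_12 by algebra
  then have "h = - real b"
    using size_bounds(1) by simp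
  then show ?thesis
    by (simp add: h_def)
qed

text \<open>Supplies \<open>ex\<close> in \<open>zero_weight_spectral_radius_le\<close>. On the
  eigenspace of \<open>- 2\<close>, \<open>(A 2 - h1) (A 2 - h2)\<close> vanishes, with real roots
  as \<open>D \<ge> 0\<close>; so \<open>x\<close> or \<open>(A 2 - h1) x\<close> serves.\<close>

lemma common_eigenvector:
  "\<exists>x h. x \<noteq> 0 \<and> (\<Sum>u\<in>UNIV. x $ u) = 0 \<and> A 1 *v x = - 2 *\<^sub>R x \<and> A 2 *v x = h *\<^sub>R x"
proof -
  obtain x where x: "x \<noteq> 0" "(\<Sum>u\<in>UNIV. x $ u) = 0" "A 1 *v x = - 2 *\<^sub>R x"
    using eigenvector_minus_2 by blast
  define q where "q = sqrt (S\<^sup>2 + 4 * D)"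
  have "0 \<le> D"
    using size_bounds(4) by (simp add: D_def)
  then have qq: "q\<^sup>2 = S\<^sup>2 + 4 * D"
    by (simp add: q_def)
  define h1 h2 where "h1 = (S + q) / 2" and "h2 = (S - q) / 2"
  have h: "h1 + h2 = S" "h1 * h2 = - D"
    using qq by (simp_all add: h1_def h2_def field_simps power2_eq_square)
  define y where "y = A 2 *v x - h1 *\<^sub>R x"
  show ?thesis
  proof (cases "y = 0")
    case True
    then have "A 2 *v x = h1 *\<^sub>R x"
      by (simp add: y_def)
    with x show ?thesis by blast
  next
    case False
    have "(\<Sum>u\<in>UNIV. y $ u) = 0"
      using sum_A_vec_component[of 2 x] x(2)
      by (simp add: y_def sum_subtractf flip: sum_distrib_left)
    moreover have "A 1 *v y = - 2 *\<^sub>R y"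
    proof -
      have "A 1 *v y = A 2 *v (A 1 *v x) - h1 *\<^sub>R (A 1 *v x)"
        unfolding y_def A_vec(4)[OF x(2)] by (simp add: matrix_vector_mult_diff_distrib matrix_vector_mult_scaleR)
      then show ?thesis
        unfolding x(3) matrix_vector_mult_scaleR y_def by (simp add: algebra_simps)
    qed
    moreover have "A 2 *v y = h2 *\<^sub>R y"
    proof -
      have "A 2 *v y = (h1 + h2) *\<^sub>R (A 2 *v x) + (- (h1 * h2)) *\<^sub>R x - h1 *\<^sub>R (A 2 *v x)"
        unfolding y_def h by (simp add: matrix_vector_mult_diff_distrib matrix_vector_mult_scaleR A_2_square[OF x(2,3)])
      then show ?thesis
        by (simp add: y_def algebra_simps)
    qed
    ultimately show ?thesis
      using False by blast
  qed
qed

text \<open>A root beyond the bound exceeds \<open>\<bar>S\<bar>\<close> by \<open>k2 / 200\<close>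
  or more in absolute value, so
  \<open>\<bar>\<eta>\<bar> * (\<bar>\<eta>\<bar> - \<bar>S\<bar>)\<close> has order
  \<open>k2\<^sup>2\<close>; but it is at most \<open>2 * k2\<close>.\<close>

lemma quadratic_root_bound:
  assumes "\<eta>\<^sup>2 = S * \<eta> + D"
  shows "\<bar>\<eta>\<bar> \<le> real (p 2 2 2) + real (deg 2) / 100"
proof (rule ccontr)
  define k2 where "k2 = real (deg 2)"
  assume "\<not> ?thesis"
  then have large: "real (p 2 2 2) + k2 / 100 < \<bar>\<eta>\<bar>"
    by (simp add: k2_def)
  have k2: "1000000 \<le> k2"
    using size_bounds(1) deg_1_eq deg_1_le_2 by (simp add: k2_def)
  have mu: "real (p 3 2 2) \<le> k2 / 200"
    using size_bounds(5) by (simp add: k2_def)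
  have "\<bar>\<eta>\<bar> * \<bar>\<eta>\<bar> = \<eta>\<^sup>2"
    by (simp add: power2_eq_square)
  also have "\<dots> \<le> S * \<eta> + 2 * k2"
    using assms mu unfolding D_def k2_def by linarith
  also have "\<dots> \<le> \<bar>S\<bar> * \<bar>\<eta>\<bar> + 2 * k2"
    by (metis abs_ge_self abs_mult add_right_mono)
  finally have "\<bar>\<eta>\<bar> * (\<bar>\<eta>\<bar> - \<bar>S\<bar>) \<le> 2 * k2"
    by (simp add: algebra_simps)
  moreover have "k2 / 100 * (k2 / 200) \<le> \<bar>\<eta>\<bar> * (\<bar>\<eta>\<bar> - \<bar>S\<bar>)"
  proof (rule mult_mono)
    have "\<bar>S\<bar> \<le> real (p 2 2 2) + k2 / 200"
      using mu unfolding S_def by linarith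
    then show "k2 / 200 \<le> \<bar>\<eta>\<bar> - \<bar>S\<bar>"
      using large by simp
  qed (use large k2 in auto)
  moreover have "2 * k2 < k2 / 100 * (k2 / 200)"
    using k2 by simp
  ultimately show False by linarith
qed

section \<open>Bounds on \<open>q + \<xi>\<close> in the two cases\<close>

lemma card_UNIV_ge_2: "2 \<le> CARD('v)"
proof -
  obtain u v where "c u v = 1" using c_surj[of 1] by auto
  then have "u \<noteq> v"
    by auto
  then have "card {u, v} = 2"
    by simp
  then show ?thesis
    by (metis card_mono finite subset_UNIV)
qed

lemma colour_cases:
  assumes "u \<noteq> v"
  obtains "c u v = 1" | "c u v = 2" | "c u v = 3"
proof -
  have "c u v \<noteq> 0" "c u v < 4"
    using assms c_less by (simp_all add: c_eq_0_iff)
  then have "c u v = 1 \<or> c u v = 2 \<or> c u v = 3"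
    by linarith
  then show ?thesis
    using that by blast
qed

text \<open>The roots of the quadratic are at most \<open>9/20 + 1/100 < 1/2\<close> of
  \<open>deg 2\<close>, and \<open>9/20 + 1/2 = 19/20\<close>.\<close>

lemma constituent_2_bound:
  assumes "real (p 2 2 2) \<le> 9 / 20 * real (deg 2)"
  shows "real (max_common_neighbours (constituent c 2)) + zero_weight_spectral_radius (constituent c 2)
    \<le> 19 / 20 * real (deg 2)"
proof -
  let ?X = "constituent c 2"
  have "real (max_common_neighbours ?X) \<le> 9 / 20 * real (deg 2)"
  proof (rule max_common_neighbours_le[OF card_UNIV_ge_2])
    fix u v :: 'v assume "u \<noteq> v"
    then show "real (card (common_neighbours ?X u v)) \<le> 9 / 20 * real (deg 2)"
      using assms size_bounds(4,5)
      by (cases rule: colour_cases) (simp_all add: card_common_neighbours_constituent)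
  qed
  moreover have "zero_weight_spectral_radius ?X \<le> 1 / 2 * real (deg 2)"
  proof (rule zero_weight_spectral_radius_le[of _ "deg 2"])
    show "?X v u" if "?X u v" for u v
      using that c_sym by (auto simp: constituent_def)
    show "regular_graph ?X (deg 2)"
      by (rule regular_constituent) auto
    have A: "adjacency_matrix ?X = A 2"
      by (rule adjacency_matrix_constituent) simp
    show "\<exists>a x. x \<noteq> 0 \<and> (\<Sum>u\<in>UNIV. x $ u) = 0 \<and> adjacency_matrix ?X *v x = a *\<^sub>R x"
      using common_eigenvector unfolding A by blast
    fix a x assume "x \<noteq> 0" "(\<Sum>u\<in>UNIV. x $ u) = 0" "adjacency_matrix ?X *v x = a *\<^sub>R x"
    then have "a = - real b \<or> a\<^sup>2 = S * a + D"
      using eigenvalue_cases[of x 0 a] by (simp add: A)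
    then show "\<bar>a\<bar> \<le> 1 / 2 * real (deg 2)"
      using quadratic_root_bound[of a] size_bounds(3) assms by auto
  qed
  ultimately show ?thesis
    by simp
qed

text \<open>\<open>q\<close> and \<open>\<xi>\<close> of \<open>X_{1,2}\<close> are each at most
  \<open>11/20 * k2\<close>; as \<open>k2 \<le> 3 * k1\<close>, their sum stays below
  \<open>19/20 * (k1 + k2)\<close>.\<close>

lemma constituent_union_bound:
  assumes lower: "9 / 20 * real (deg 2) < real (p 2 2 2)"
  shows "real (max_common_neighbours (constituent_union c 1 2))
      + zero_weight_spectral_radius (constituent_union c 1 2)
    \<le> 19 / 20 * real (deg 1 + deg 2)"
proof -
  let ?X = "constituent c 2" and ?Y = "constituent_union c 1 2"
  define k1 k2 where "k1 = real (deg 1)" and "k2 = real (deg 2)"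
  have k12: "k1 \<le> k2"
    using deg_1_le_2 by (simp add: k1_def k2_def)
  have k1: "k1 = 2 * R + real m" "10000 \<le> R"
    using deg_1_eq size_bounds(1) by (simp_all add: k1_def)
  have small: "10000 * real m \<le> k1" "10000 * real b \<le> k2" "10000 * real (p 1 2 2) \<le> k2"
    "10000 * real (p 3 2 2) \<le> k2"
    using size_bounds(2-5) by (simp_all add: k1_def k2_def)
  define t where "t = max (p 1 2 2) (p 3 2 2)"
  have t: "10000 * real t \<le> k2"
    using small by (simp add: t_def max_def)
  have sym: "?X v u" if "?X u v" for u v
    using that c_sym by (auto simp: constituent_def)
  have irr: "\<not> ?X u u" for u
    by (simp add: constituent_def)
  have reg: "regular_graph ?X (deg 2)"
    by (rule regular_constituent) auto
  have cn: "card (common_neighbours ?X u v) = p (c u v) 2 2" for u v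
    by (rule card_common_neighbours_constituent) auto
  have adj: "card (common_neighbours ?X u v) = p 2 2 2" if "?X u v" for u v
    unfolding cn using that by (simp add: constituent_def)
  have nadj: "card (common_neighbours ?X u v) \<le> t" if "u \<noteq> v" "\<not> ?X u v" for u v
    unfolding cn using that(1)
    by (cases rule: colour_cases) (use that(2) in \<open>auto simp: t_def constituent_def\<close>)
  \<comment> \<open>The common \<open>X_2\<close>-neighbour \<open>w0\<close> of two vertices at
    colour 3 has two nonadjacent neighbours, as needed for \<open>upper\<close>.\<close>
  obtain u0 v0 where uv0: "c u0 v0 = 3" using c_surj[of 3] by auto
  then have "0 < card (common_neighbours ?X u0 v0)"
    using p_pos[of 2] by (simp add: cn)
  then obtain w0 where "w0 \<in> common_neighbours ?X u0 v0"
    by (metis card_gt_0_iff ex_in_conv)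
  then have w0: "?X w0 u0" "?X w0 v0"
    using sym by (auto simp: common_neighbours_def)
  have "u0 \<noteq> v0" "\<not> ?X u0 v0"
    using uv0 by (auto simp: constituent_def)
  then have "2 * p 2 2 2 \<le> deg 2 + t"
    using two_mult_common_neighbours_le[OF reg adj nadj w0] by blast
  then have upper: "2 * real (p 2 2 2) \<le> k2 + real t"
    unfolding k2_def by linarith
  have big: "10000 \<le> k2"
    using k1 k12 by simp
  \<comment> \<open>\<open>l1\<close> rests on \<open>27/20 > 1\<close> and \<open>l2\<close> on
    \<open>3/2 < 2\<close>, with \<open>t\<close> negligible.\<close>
  have "real (deg 2 + 3 * t) < real (3 * p 2 2 2)"
    using lower t big by (simp add: k2_def)
  then have l1: "deg 2 + 3 * t < 3 * p 2 2 2"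
    by (simp only: of_nat_less_iff)
  have "real (3 * p 2 2 2 + t + 3) < real (2 * deg 2)"
    using upper t big by (simp add: k2_def)
  then have l2: "3 * p 2 2 2 + t + 3 < 2 * deg 2"
    by (simp only: of_nat_less_iff)
  have p1: "p 1 2 2 \<le> 4"
  proof -
    obtain u v where uv: "c u v = 1" using c_surj[of 1] by auto
    then have "u \<noteq> v" "\<not> ?X u v"
      by (auto simp: constituent_def)
    then show ?thesis
      using common_neighbours_le_4[OF sym irr reg adj nadj l1 l2, of u v] cn[of u v] uv by simp
  qed
  \<comment> \<open>Otherwise \<open>b = m * k2 / k1 > 3\<close>, and
    \<open>p 1 2 2 = (2 * b - 2) * k2 / k1 > 12\<close> contradicts \<open>p1\<close>.\<close>
  have k21: "k2 \<le> 3 * k1"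
  proof (rule ccontr)
    assume "\<not> k2 \<le> 3 * k1"
    then have less: "3 * k1 < k2" by simp
    have pos: "0 < k1"
      using deg_pos[of 1] by (simp add: k1_def)
    have "k1 * 3 \<le> k2 * real m"
      using less m_pos mult_left_mono[of 1 "real m" k2] by (simp add: k2_def)
    also have "\<dots> = k1 * real b"
      using edge_counts(1)[THEN arg_cong[of _ _ real]] by (simp add: k1_def k2_def)
    finally have "3 \<le> real b"
      using pos by simp
    have "k1 * 12 < k2 * 4"
      using less by simp
    also have "\<dots> \<le> k2 * (2 * real b - 2)"
      using \<open>3 \<le> real b\<close> by (intro mult_left_mono) (simp_all add: k2_def)
    also have "\<dots> = k1 * real (p 1 2 2)"
      using edge_counts(4)[THEN arg_cong[of _ _ real]] p_12(2) by (simp add: k1_def k2_def)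
    also have "\<dots> \<le> k1 * 4"
      using p1 pos by simp
    finally show False
      using pos by simp
  qed
  have "real (max_common_neighbours ?Y) \<le> 11 / 20 * k2"
  proof (rule max_common_neighbours_le[OF card_UNIV_ge_2])
    fix u v :: 'v assume uv: "u \<noteq> v"
    let ?T = "\<lambda>i j. {w. c u w = i \<and> c w v = j}"
    have cnY: "common_neighbours ?Y u v = (?T 1 1 \<union> ?T 1 2) \<union> (?T 2 1 \<union> ?T 2 2)"
      using c_sym by (auto simp: common_neighbours_def constituent_union_def)
    have "card (common_neighbours ?Y u v) \<le> card (?T 1 1) + card (?T 1 2) + (card (?T 2 1) + card (?T 2 2))"
      unfolding cnY
      using card_Un_le[of "?T 1 1 \<union> ?T 1 2" "?T 2 1 \<union> ?T 2 2"] card_Un_le[of "?T 1 1" "?T 1 2"]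
        card_Un_le[of "?T 2 1" "?T 2 2"] by linarith
    also have "\<dots> = p (c u v) 1 1 + 2 * p (c u v) 1 2 + p (c u v) 2 2"
      using card_triangles[of _ _ u v] intersection_number_sym[of 2 1 "c u v"] c_less[of u v] by simp
    finally have "real (card (common_neighbours ?Y u v))
        \<le> real (p (c u v) 1 1) + 2 * real (p (c u v) 1 2) + real (p (c u v) 2 2)"
      by linarith
    \<comment> \<open>Colour 1 is dominated by \<open>l\<close>, about \<open>k1 / 2\<close>; colour
      2 by \<open>p 2 2 2\<close>, at most about \<open>k2 / 2\<close>; at colour 3 all terms are
      small.\<close>
    also have "\<dots> \<le> 11 / 20 * k2"
      using uv
    proof (cases rule: colour_cases)
      case 1
      then show ?thesis
        using small k1 k12 l_eq p_11(1) by simp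
    next
      case 2
      then show ?thesis
        using small k1 k12 upper t p_12(2) p_11(2) by simp
    next
      case 3
      then show ?thesis
        using small k1 k12 p_12(1) p_11(3) by simp
    qed
    finally show "real (card (common_neighbours ?Y u v)) \<le> 11 / 20 * k2" .
  qed
  moreover have "zero_weight_spectral_radius ?Y \<le> 11 / 20 * k2"
  proof (rule zero_weight_spectral_radius_le[of _ "deg 1 + deg 2"])
    show "?Y v u" if "?Y u v" for u v
      using that c_sym by (simp add: constituent_union_def)
    have "{v. ?Y u v} = {v. c u v = 1} \<union> {v. c u v = 2}" for u
      by (auto simp: constituent_union_def)
    moreover have "card ({v. c u v = 1} \<union> {v. c u v = 2}) = deg 1 + deg 2" for u
      using card_sphere[of 1 u] card_sphere[of 2 u] by (subst card_Un_disjoint) auto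
    ultimately show "regular_graph ?Y (deg 1 + deg 2)"
      by (simp add: regular_graph_def)
    have "adjacency_matrix ?Y = A 1 + A 2"
      by (auto simp: adjacency_matrix_def A_def constituent_union_def vec_eq_iff)
    then have A: "adjacency_matrix ?Y *v x = A 1 *v x + A 2 *v x" for x
      by (simp add: matrix_vector_mult_add_rdistrib)
    obtain x h where x: "x \<noteq> 0" "(\<Sum>u\<in>UNIV. x $ u) = 0" "A 1 *v x = - 2 *\<^sub>R x" "A 2 *v x = h *\<^sub>R x"
      using common_eigenvector by blast
    have "adjacency_matrix ?Y *v x = (h - 2) *\<^sub>R x"
      unfolding A x(3,4) by (simp add: algebra_simps)
    with x show "\<exists>a x. x \<noteq> 0 \<and> (\<Sum>u\<in>UNIV. x $ u) = 0 \<and> adjacency_matrix ?Y *v x = a *\<^sub>R x"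
      by blast
    fix a x assume "x \<noteq> 0" "(\<Sum>u\<in>UNIV. x $ u) = 0" "adjacency_matrix ?Y *v x = a *\<^sub>R x"
    then have "a = R - real b \<or> (a + 2)\<^sup>2 = S * (a + 2) + D"
      using eigenvalue_cases[of x 1 a] unfolding A by simp
    \<comment> \<open>\<open>R\<close> is about half of \<open>k1\<close>, and the roots of the
      quadratic are at most slightly above half of \<open>k2\<close>.\<close>
    then show "\<bar>a\<bar> \<le> 11 / 20 * k2"
    proof
      assume "a = R - real b"
      then show ?thesis
        using small k1 k12 by linarith
    next
      assume "(a + 2)\<^sup>2 = S * (a + 2) + D"
      then have "\<bar>a + 2\<bar> \<le> real (p 2 2 2) + k2 / 100"
        using quadratic_root_bound by (simp add: k2_def)
      then show ?thesis
        using upper t big by linarith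
    qed
  qed
  ultimately show ?thesis
    using k21 big by (simp add: k1_def k2_def)
qed

end

theorem theorem5p8:
  fixes c :: "'v::finite \<Rightarrow> 'v \<Rightarrow> nat" and \<epsilon> :: real
  assumes "association_scheme 4 c"
    and "CARD('v) \<ge> 29"
    and "scheme_diameter_2 4 c"
    and "constituent_degree c 1 \<le> constituent_degree c 2"
    and "constituent_degree c 2 \<le> constituent_degree c 3"
    and "\<epsilon> = 1 / 10 ^ 26"
    and "real (constituent_degree c 2) \<le> \<epsilon> * real (constituent_degree c 3) / 2"
    and "\<exists>k l m. strongly_regular_graph (constituent c 1) k l m"
    and "smallest_eigenvalue (constituent c 1) = - 2"
  shows "\<exists>Y k\<^sub>Y.
           (Y = constituent c 2 \<and> k\<^sub>Y = constituent_degree c 2 \<or>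
            Y = constituent_union c 1 2 \<and> k\<^sub>Y = constituent_degree c 1 + constituent_degree c 2) \<and>
           real (max_common_neighbours Y) + zero_weight_spectral_radius Y \<le> (1 - \<epsilon>) * real k\<^sub>Y"
proof -
  obtain k l m where srg: "strongly_regular_graph (constituent c 1) k l m"
    using assms(8) by blast
  have "real (2 * 10 ^ 26 * constituent_degree c 2) \<le> real (constituent_degree c 3)"
    using assms(7) unfolding assms(6) by simp
  then have "2 * 10 ^ 26 * constituent_degree c 2 \<le> constituent_degree c 3"
    by (simp only: of_nat_le_iff)
  then interpret srg_scheme c k l m
    using assms srg by unfold_locales auto
  have eps: "19 / 20 * real n \<le> (1 - \<epsilon>) * real n" for n
    using assms(6) by (intro mult_right_mono) auto
  show ?thesis
  \<comment> \<open>Up to \<open>9/20\<close>, a share of \<open>1/2\<close> is left for the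
    eigenvalues; above it, \<open>3 * 9/20 > 1\<close> excludes three pairwise nonadjacent
    neighbours of a vertex.\<close>
  proof (cases "real (p 2 2 2) \<le> 9 / 20 * real (deg 2)")
    case True
    then show ?thesis
      using constituent_2_bound eps[of "deg 2"] by (intro exI[of _ "constituent c 2"] exI[of _ "deg 2"]) auto
  next
    case False
    then show ?thesis
      using constituent_union_bound eps[of "deg 1 + deg 2"]
      by (intro exI[of _ "constituent_union c 1 2"] exI[of _ "deg 1 + deg 2"]) auto
  qed
qed

end
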